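(* Let $(p_d)_{d\ge1}$, $p_d=(p_{d,1},\dots,p_{d,d})\in[0,1]^d$, and for each $d$ let $X_{d,1},\dots,X_{d,d}$ be independent with $X_{d,i}\sim\mathrm{Bern}(p_{d,i})$. Assume: (1) the bandwidth $k=k_d$ satisfies $k/d\to\alpha\in(0,1)$ as $d\to\infty$; (2) there is a monotone increasing càdlàg function $F:[0,1]\to[0,1]$ with $\lim_{t\to0}F(t)=0$ and $\lim_{t\to1}F(t)=1$ such that $\frac1d\sum_{i=1}^d\mathbf{1}(p_{d,i}\le t)\to F(t)$ as $d\to\infty$ for all continuity points $t$ of $F$; (3) $\alpha\in\left(0,\int_0^1Q^*(q)\,dq\right)$. Let $\beta^*\in(0,1)$ satisfy $\int_0^{\beta^*}Q^*(q)\,dq=\alpha$. Then the greedy highlighting policy $\sigma^{\mathrm{gr}}$ has the following asymptotic normalized risks. (i) Sophisticated agent: $$\lim_{d\to\infty}\bar R^S_d(\sigma^{\mathrm{gr}})=\int_{\beta^*}^1Q^*(q)\bigl(1-Q^*(q)\bigr)\,dq.$$ (ii) Naive agent: $$\lim_{d\to\infty}\bar R^N_d(\sigma^{\mathrm{gr}})=\int_0^{\beta^*}\bigl(Q^*(q)\bigr)^2\bigl(1-Q^*(q)\bigr)\,dq+\int_{\beta^*}^1Q^*(q)\bigl(1-Q^*(q)\bigr)\,dq.$$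
   Context: Transformed quantities. For all $d,i$: $p^*_{d,i}=\min(p_{d,i},1-p_{d,i})$; $X^*_{d,i}=X_{d,i}$ if $p_{d,i}\le\frac12$ and $X^*_{d,i}=1-X_{d,i}$ otherwise. $F^*(t)=F(t)+1-F(1-t)$ for $t\le\frac12$ and $F^*(t)=1$ for $t>\frac12$. $Q^*(q)=\inf\{t\in[0,1]:F^*(t)\ge q\}$. For each $d$ fix an ordering of the coordinates such that $p^*_{d,(1)}\le\dots\le p^*_{d,(d)}$, and let $X^*_{d,(j)}\sim\mathrm{Bern}(p^*_{d,(j)})$ be the correspondingly ordered realizations. Highlighting and agents. A highlighting policy $\sigma$ maps each realization $x\in\{0,1\}^d$ to a set $I=\sigma(x)$ of coordinates; the agent observes $I$ and $(X_{d,i})_{i\in I}$ (revealing $X^*_{d,i}$ is equivalent to revealing $X_{d,i}$, since $p_d$ is known) and, with action set $\mathbb{R}^d$ and squared recovery loss $\ell(a,x)=\|a-x\|_2^2$, plays the posterior mean $\hat a$ of $X_d$. The naive agent ($N$) uses the posterior $\mathbb{P}(\cdot\mid X_I)$, treating $I$ as exogenous; the sophisticated agent ($S$) knows $\sigma$ and uses the posterior $\mathbb{P}(\cdot\mid X_I,\sigma(X)=I)$. For $\tau\in\{N,S\}$, the normalized risk is $\bar R^\tau_d(\sigma)=\frac1d\,\mathbb{E}\|\hat a^\tau-X_d\|_2^2$. Greedy policy $\sigma^{\mathrm{gr}}$ (bandwidth $k$): highlight $X^*_{d,(j)}$ for the first (smallest) $k$ indices $j$ with $X^*_{d,(j)}=1$;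 if there are fewer than $k$ such indices, add the highest indices $j$ with $X^*_{d,(j)}=0$. (This highlights $k$ coordinates with the largest values of $(X_{d,i}-p_{d,i})^2$.) *)

theory Defs
  imports "HOL-Probability.Probability"
begin

text \<open>
  Coordinates are indexed by \<^term>\<open>{1..d}\<close>. A parameter vector is a function
  \<^typ>\<open>nat \<Rightarrow> real\<close> and a realization in \<open>{0,1}\<^sup>d\<close> a function
  \<^typ>\<open>nat \<Rightarrow> bool\<close>, of which only the values on \<^term>\<open>{1..d}\<close> matter.
\<close>

definition pstar :: "(nat \<Rightarrow> real) \<Rightarrow> nat \<Rightarrow> real" where
  "pstar p i = min (p i) (1 - p i)"

definition xstar :: "(nat \<Rightarrow> real) \<Rightarrow> (nat \<Rightarrow> bool) \<Rightarrow> nat \<Rightarrow> bool" where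
  "xstar p x i = (if p i \<le> 1/2 then x i else \<not> x i)"

definition Fstar :: "(real \<Rightarrow> real) \<Rightarrow> real \<Rightarrow> real" where
  "Fstar F t = (if t \<le> 1/2 then F t + 1 - F (1 - t) else 1)"

definition Qstar :: "(real \<Rightarrow> real) \<Rightarrow> real \<Rightarrow> real" where
  "Qstar F q = Inf {t \<in> {0..1}. Fstar F t \<ge> q}"

definition cadlag_on :: "real \<Rightarrow> real \<Rightarrow> (real \<Rightarrow> real) \<Rightarrow> bool" where
  "cadlag_on a b F \<longleftrightarrow>
     (\<forall>t\<in>{a..<b}. (F \<longlongrightarrow> F t) (at_right t)) \<and>
     (\<forall>t\<in>{a<..b}. \<exists>l. (F \<longlongrightarrow> l) (at_left t))"

text \<open>
  \<open>\<pi> j\<close> is the coordinate in position \<open>j\<close> of the chosen ordering, so that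
  \<open>pstar p (\<pi> j)\<close> is the \<open>j\<close>-th smallest transformed parameter. Ties may be broken arbitrarily.
\<close>

definition pstar_ordering :: "nat \<Rightarrow> (nat \<Rightarrow> real) \<Rightarrow> (nat \<Rightarrow> nat) \<Rightarrow> bool" where
  "pstar_ordering d p \<pi> \<longleftrightarrow>
     bij_betw \<pi> {1..d} {1..d} \<and> mono_on {1..d} (\<lambda>j. pstar p (\<pi> j))"

text \<open>
  An index with \<open>xstar = 1\<close> is taken if it is among the \<open>k\<close> smallest such indices. An index with
  \<open>xstar = 0\<close> is taken if it is among the \<open>k - card ones\<close> largest such indices; the truncated
  subtraction makes this condition void when there are at least \<open>k\<close> ones.
\<close>

definition greedy :: "nat \<Rightarrow> (nat \<Rightarrow> real) \<Rightarrow> (nat \<Rightarrow> nat) \<Rightarrow> nat \<Rightarrow> (nat \<Rightarrow> bool) \<Rightarrow> nat set" where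
  "greedy d p \<pi> k x =
     (let ones  = {j \<in> {1..d}. xstar p x (\<pi> j)};
          zeros = {j \<in> {1..d}. \<not> xstar p x (\<pi> j)}
      in \<pi> ` ({j \<in> ones. card {i \<in> ones. i \<le> j} \<le> k} \<union>
              {j \<in> zeros. card {i \<in> zeros. j \<le> i} \<le> k - card ones}))"

definition realization :: "nat \<Rightarrow> (nat \<Rightarrow> 'a \<Rightarrow> bool) \<Rightarrow> 'a \<Rightarrow> nat \<Rightarrow> bool" where
  "realization d X \<omega> = (\<lambda>i\<in>{1..d}. X i \<omega>)"

text \<open>
  Observations take finitely many values, so posteriors are elementary conditional distributions:
  \<^term>\<open>uniform_measure M A\<close> is \<^term>\<open>M\<close> conditioned on the event \<^term>\<open>A\<close>. The outcome
  \<open>\<omega>\<close> fixes what the agent sees. The naive agent conditions on the revealed values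
  with the set \<open>I = \<sigma>(X(\<omega>))\<close> held fixed; the sophisticated agent also
  conditions on the event that this set is chosen.
\<close>

definition naive_posterior ::
  "nat \<Rightarrow> 'a measure \<Rightarrow> (nat \<Rightarrow> 'a \<Rightarrow> bool) \<Rightarrow> ((nat \<Rightarrow> bool) \<Rightarrow> nat set) \<Rightarrow> 'a \<Rightarrow> 'a measure" where
  "naive_posterior d M X \<sigma> \<omega> =
     (let I = \<sigma> (realization d X \<omega>)
      in uniform_measure M {\<omega>' \<in> space M. \<forall>i\<in>I. X i \<omega>' = X i \<omega>})"

definition sophisticated_posterior ::
  "nat \<Rightarrow> 'a measure \<Rightarrow> (nat \<Rightarrow> 'a \<Rightarrow> bool) \<Rightarrow> ((nat \<Rightarrow> bool) \<Rightarrow> nat set) \<Rightarrow> 'a \<Rightarrow> 'a measure" where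
  "sophisticated_posterior d M X \<sigma> \<omega> =
     (let I = \<sigma> (realization d X \<omega>)
      in uniform_measure M
           {\<omega>' \<in> space M. (\<forall>i\<in>I. X i \<omega>' = X i \<omega>) \<and> \<sigma> (realization d X \<omega>') = I})"

definition posterior_mean :: "(nat \<Rightarrow> 'a \<Rightarrow> bool) \<Rightarrow> 'a measure \<Rightarrow> nat \<Rightarrow> real" where
  "posterior_mean X P i = (\<integral>\<omega>. of_bool (X i \<omega>) \<partial>P)"

definition recovery_loss :: "nat \<Rightarrow> (nat \<Rightarrow> real) \<Rightarrow> (nat \<Rightarrow> bool) \<Rightarrow> real" where
  "recovery_loss d a x = (\<Sum>i\<in>{1..d}. (a i - of_bool (x i))\<^sup>2)"

definition naive_risk ::
  "nat \<Rightarrow> 'a measure \<Rightarrow> (nat \<Rightarrow> 'a \<Rightarrow> bool) \<Rightarrow> ((nat \<Rightarrow> bool) \<Rightarrow> nat set) \<Rightarrow> real" where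
  "naive_risk d M X \<sigma> =
     (\<integral>\<omega>. recovery_loss d (posterior_mean X (naive_posterior d M X \<sigma> \<omega>))
            (realization d X \<omega>) \<partial>M) / real d"

definition sophisticated_risk ::
  "nat \<Rightarrow> 'a measure \<Rightarrow> (nat \<Rightarrow> 'a \<Rightarrow> bool) \<Rightarrow> ((nat \<Rightarrow> bool) \<Rightarrow> nat set) \<Rightarrow> real" where
  "sophisticated_risk d M X \<sigma> =
     (\<integral>\<omega>. recovery_loss d (posterior_mean X (sophisticated_posterior d M X \<sigma> \<omega>))
            (realization d X \<omega>) \<partial>M) / real d"

end

theory Submission
  imports Defs
begin

text \<open>
  Order the coordinates by \<open>p\<^sup>*\<close>, fix \<open>b = \<lfloor>\<beta> d\<rfloor>\<close> and let \<open>N\<close> be the number of ones of \<open>X\<^sup>*\<close> among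
  the first \<open>b\<close> positions. The greedy set differs from the set of these ones in exactly
  \<open>\<bar>k - N\<bar>\<close> positions (if \<open>k \<le> d\<close>), whether or not there are \<open>k\<close> ones in total. Hence the naive loss is,
  up to \<open>\<bar>k - N\<bar>\<close>, the loss of an agent who is shown the ones among the first \<open>b\<close> positions, whose
  expectation is an explicit sum. The sophisticated loss is bounded above by the loss of the estimator
  that guesses \<open>X\<^sup>* = 0\<close> at hidden positions up to \<open>b\<close>, and below by noting that a position
  preceded by at least \<open>k\<close> ones is independent of the observation; the exceptional positions
  after \<open>b\<close> that carry a one number at most \<open>\<bar>k - N\<bar>\<close>. Finally \<open>E \<bar>k - N\<bar> \<le> \<bar>k - E N\<bar> + \<surd>d = o(d)\<close>,
  and the averages over ordered parameters converge to integrals of \<open>Q\<^sup>*\<close> by dominated convergence,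
  since empirical quantiles converge at continuity points of \<open>Q\<^sup>*\<close>.
\<close>

section \<open>Finite products of Bernoulli distributions\<close>

definition bernE :: "'i set \<Rightarrow> ('i \<Rightarrow> real) \<Rightarrow> (('i \<Rightarrow> bool) \<Rightarrow> real) \<Rightarrow> real" where
  "bernE A p f = (\<Sum>x\<in>PiE A (\<lambda>_. UNIV). (\<Prod>i\<in>A. if x i then p i else 1 - p i) * f x)"

lemma bernE_insert:
  assumes "finite A" "j \<notin> A"
  shows "bernE (insert j A) p f =
    bernE A p (\<lambda>x. p j * f (x(j := True)) + (1 - p j) * f (x(j := False)))"
proof -
  let ?g = "\<lambda>(b, x). x(j := b)"
  have "bernE (insert j A) p f = (\<Sum>z\<in>UNIV \<times> PiE A (\<lambda>_. UNIV).
      (\<Prod>i\<in>insert j A. if ?g z i then p i else 1 - p i) * f (?g z))"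
    unfolding bernE_def PiE_insert_eq
    by (rule sum.reindex[OF inj_combinator[OF assms(2)], unfolded o_def])
  also have "\<dots> = (\<Sum>z\<in>UNIV \<times> PiE A (\<lambda>_. UNIV).
      (if fst z then p j else 1 - p j) * (\<Prod>i\<in>A. if snd z i then p i else 1 - p i) *
      f ((snd z)(j := fst z)))"
    using assms by (intro sum.cong refl) (auto simp: case_prod_unfold intro!: prod.cong)
  also have "\<dots> = (\<Sum>b\<in>UNIV. \<Sum>x\<in>PiE A (\<lambda>_. UNIV).
      (if b then p j else 1 - p j) * (\<Prod>i\<in>A. if x i then p i else 1 - p i) * f (x(j := b)))"
    by (simp add: sum.cartesian_product case_prod_unfold)
  also have "\<dots> = bernE A p (\<lambda>x. p j * f (x(j := True)) + (1 - p j) * f (x(j := False)))"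
    unfolding bernE_def UNIV_bool by (simp add: sum.distrib[symmetric] algebra_simps)
  finally show ?thesis .
qed

lemma bernE_resample:
  assumes "finite A" "j \<in> A"
  shows "bernE A p f = bernE A p (\<lambda>x. p j * f (x(j := True)) + (1 - p j) * f (x(j := False)))"
proof -
  obtain B where "A = insert j B" "j \<notin> B" "finite B"
    using assms by (metis finite_insert mk_disjoint_insert)
  then show ?thesis
    by (simp add: bernE_insert algebra_simps)
qed

lemma bernE_cong: "(\<And>x. x \<in> PiE A (\<lambda>_. UNIV) \<Longrightarrow> f x = g x) \<Longrightarrow> bernE A p f = bernE A p g"
  by (simp add: bernE_def)

lemma bernE_cong_pos:
  assumes "\<And>x. x \<in> PiE A (\<lambda>_. UNIV) \<Longrightarrow> (\<Prod>i\<in>A. if x i then p i else 1 - p i) \<noteq> 0 \<Longrightarrow> f x = g x"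
  shows "bernE A p f = bernE A p g"
  unfolding bernE_def
proof (rule sum.cong[OF refl])
  fix x assume "x \<in> PiE A (\<lambda>_. UNIV :: bool set)"
  then show "(\<Prod>i\<in>A. if x i then p i else 1 - p i) * f x = (\<Prod>i\<in>A. if x i then p i else 1 - p i) * g x"
    using assms[of x] by (cases "(\<Prod>i\<in>A. if x i then p i else 1 - p i) = 0") simp_all
qed

lemma bernE_add: "bernE A p (\<lambda>x. f x + g x) = bernE A p f + bernE A p g"
  by (simp add: bernE_def distrib_left sum.distrib)

lemma bernE_diff: "bernE A p (\<lambda>x. f x - g x) = bernE A p f - bernE A p g"
  by (simp add: bernE_def right_diff_distrib sum_subtractf)

lemma bernE_cmult: "bernE A p (\<lambda>x. c * f x) = c * bernE A p f"
  by (simp add: bernE_def sum_distrib_left mult.left_commute)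

lemma bernE_sum: "bernE A p (\<lambda>x. \<Sum>i\<in>I. f i x) = (\<Sum>i\<in>I. bernE A p (f i))"
  unfolding bernE_def sum_distrib_left by (rule sum.swap)

lemma bernE_const: "finite A \<Longrightarrow> bernE A p (\<lambda>_. c) = c"
  by (induction rule: finite_induct) (simp_all add: bernE_insert algebra_simps, simp add: bernE_def)

lemma bern_weight_nonneg:
  "(\<And>i. i \<in> A \<Longrightarrow> p i \<in> {0..1}) \<Longrightarrow> 0 \<le> (\<Prod>i\<in>A. if x i then p i else 1 - (p i :: real))"
  by (intro prod_nonneg) auto

lemma bernE_mono:
  assumes "\<And>i. i \<in> A \<Longrightarrow> p i \<in> {0..1}"
    and "\<And>x. x \<in> PiE A (\<lambda>_. UNIV) \<Longrightarrow> f x \<le> g x"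
  shows "bernE A p f \<le> bernE A p g"
  unfolding bernE_def
  by (intro sum_mono mult_left_mono bern_weight_nonneg assms)

definition cond_mean ::
    "'i set \<Rightarrow> ('i \<Rightarrow> real) \<Rightarrow> ('i \<Rightarrow> bool) set \<Rightarrow> (('i \<Rightarrow> bool) \<Rightarrow> real) \<Rightarrow> real" where
  "cond_mean A p S f = bernE A p (\<lambda>x. of_bool (x \<in> S) * f x) / bernE A p (\<lambda>x. of_bool (x \<in> S))"

lemma cond_mean_optimal:
  fixes obs :: "('i \<Rightarrow> bool) \<Rightarrow> 'o"
  assumes fin: "finite A" and p: "\<And>i. i \<in> A \<Longrightarrow> p i \<in> {0..1}"
    and h: "\<And>x y. x \<in> PiE A (\<lambda>_. UNIV) \<Longrightarrow> y \<in> PiE A (\<lambda>_. UNIV) \<Longrightarrow> obs x = obs y \<Longrightarrow> h x = h y"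
  shows "bernE A p (\<lambda>x. (cond_mean A p {y. obs y = obs x} f - f x)\<^sup>2)
     \<le> bernE A p (\<lambda>x. (h x - f x)\<^sup>2)"
proof -
  let ?\<Omega> = "PiE A (\<lambda>_. UNIV :: bool set)"
  let ?w = "\<lambda>x. \<Prod>i\<in>A. if x i then p i else 1 - p i"
  have fin\<Omega>: "finite ?\<Omega>" using fin by (auto intro: finite_PiE)
  have split: "bernE A p g = (\<Sum>v\<in>obs ` ?\<Omega>. \<Sum>x\<in>{x\<in>?\<Omega>. obs x = v}. ?w x * g x)" for g
    unfolding bernE_def by (rule sum.image_gen) (rule fin\<Omega>)
  show ?thesis
    unfolding split
  proof (rule sum_mono)
    fix v assume "v \<in> obs ` ?\<Omega>"
    then obtain z where z: "z \<in> ?\<Omega>" "v = obs z" by auto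
    let ?S = "{x\<in>?\<Omega>. obs x = v}"
    define W where "W = (\<Sum>x\<in>?S. ?w x)"
    define V where "V = (\<Sum>x\<in>?S. ?w x * f x)"
    define T where "T = (\<Sum>x\<in>?S. ?w x * (f x)\<^sup>2)"
    have sumS: "bernE A p (\<lambda>x. of_bool (x \<in> {y. obs y = v}) * g x) = (\<Sum>x\<in>?S. ?w x * g x)" for g
      unfolding bernE_def sum.inter_filter[OF fin\<Omega>] by (intro sum.cong) auto
    have cm: "cond_mean A p {y. obs y = v} f = V / W"
      using sumS[of f] sumS[of "\<lambda>_. 1"] by (simp add: cond_mean_def V_def W_def)
    have expand: "(\<Sum>x\<in>?S. ?w x * (c - f x)\<^sup>2) = W * c\<^sup>2 - 2 * c * V + T" for c
      by (simp add: W_def V_def T_def sum_distrib_left sum_distrib_right sum_subtractf[symmetric]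
          sum.distrib[symmetric] power2_eq_square algebra_simps)
    have W0: "W \<ge> 0" unfolding W_def by (intro sum_nonneg bern_weight_nonneg p)
    have V0: "V = 0" if "W = 0"
    proof -
      have "\<forall>x\<in>?S. ?w x = 0"
        using that unfolding W_def
        by (subst (asm) sum_nonneg_eq_0_iff) (use fin\<Omega> in \<open>auto intro!: bern_weight_nonneg p\<close>)
      then show ?thesis unfolding V_def by (intro sum.neutral) auto
    qed
    have "W * (V / W)\<^sup>2 - 2 * (V / W) * V + T \<le> W * c\<^sup>2 - 2 * c * V + T" for c
    proof (cases "W = 0")
      case False
      then have "W * c\<^sup>2 - 2 * c * V - (W * (V / W)\<^sup>2 - 2 * (V / W) * V) = W * (c - V / W)\<^sup>2"
        by (simp add: field_simps power2_eq_square)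
      moreover have "W * (c - V / W)\<^sup>2 \<ge> 0" using W0 by simp
      ultimately show ?thesis by linarith
    qed (simp add: V0)
    note opt = this
    have "(\<Sum>x\<in>?S. ?w x * (cond_mean A p {y. obs y = obs x} f - f x)\<^sup>2)
        = (\<Sum>x\<in>?S. ?w x * (V / W - f x)\<^sup>2)"
      by (intro sum.cong) (auto simp: cm)
    also have "\<dots> \<le> (\<Sum>x\<in>?S. ?w x * (h z - f x)\<^sup>2)"
      unfolding expand by (rule opt)
    also have "\<dots> = (\<Sum>x\<in>?S. ?w x * (h x - f x)\<^sup>2)"
    proof (rule sum.cong[OF refl])
      fix x assume "x \<in> ?S"
      then have "h z = h x" using z by (intro h) auto
      then show "?w x * (h z - f x)\<^sup>2 = ?w x * (h x - f x)\<^sup>2" by simp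
    qed
    finally show "(\<Sum>x\<in>?S. ?w x * (cond_mean A p {y. obs y = obs x} f - f x)\<^sup>2)
        \<le> (\<Sum>x\<in>?S. ?w x * (h x - f x)\<^sup>2)" .
  qed
qed

lemma cond_mean_observed:
  assumes fin: "finite A" and p: "\<And>i. i \<in> A \<Longrightarrow> p i \<in> {0..1}"
    and x: "x \<in> PiE A (\<lambda>_. UNIV)" "x \<in> S"
    and pos: "(\<Prod>i\<in>A. if x i then p i else 1 - p i) \<noteq> 0"
    and c: "\<And>y. y \<in> S \<Longrightarrow> f y = c"
  shows "cond_mean A p S f = c"
proof -
  let ?w = "\<lambda>x. \<Prod>i\<in>A. if x i then p i else 1 - p i"
  have "?w x * of_bool (x \<in> S) \<le> bernE A p (\<lambda>x. of_bool (x \<in> S))"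
    unfolding bernE_def
    by (rule member_le_sum) (use x fin in \<open>auto intro!: finite_PiE mult_nonneg_nonneg bern_weight_nonneg p\<close>)
  moreover have "?w x > 0" using pos bern_weight_nonneg[of A p x] p by fastforce
  ultimately have "bernE A p (\<lambda>x. of_bool (x \<in> S)) \<noteq> 0" using x by simp
  moreover have "bernE A p (\<lambda>x. of_bool (x \<in> S) * f x) = c * bernE A p (\<lambda>x. of_bool (x \<in> S))"
    unfolding bernE_cmult[symmetric] by (intro bernE_cong) (auto simp: c)
  ultimately show ?thesis by (simp add: cond_mean_def)
qed

lemma cond_mean_unobserved:
  assumes fin: "finite A" and p: "\<And>i. i \<in> A \<Longrightarrow> p i \<in> {0..1}"
    and x: "x \<in> PiE A (\<lambda>_. UNIV)" "x \<in> S"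
    and pos: "(\<Prod>i\<in>A. if x i then p i else 1 - p i) \<noteq> 0"
    and j: "j \<in> A" "\<And>y b. y(j := b) \<in> S \<longleftrightarrow> y \<in> S"
  shows "cond_mean A p S (\<lambda>y. of_bool (y j)) = p j"
proof -
  have "bernE A p (\<lambda>y. of_bool (y \<in> S) * of_bool (y j)) = bernE A p (\<lambda>y. of_bool (y \<in> S) * p j)"
    by (subst bernE_resample[OF fin j(1)]) (simp add: j mult.commute)
  then have "cond_mean A p S (\<lambda>y. of_bool (y j)) = cond_mean A p S (\<lambda>_. p j)"
    by (simp add: cond_mean_def)
  then show ?thesis using cond_mean_observed[OF fin p x pos, of "\<lambda>_. p j"] by simp
qed

context prob_space
begin

lemma
  fixes X :: "nat \<Rightarrow> 'a \<Rightarrow> bool" and f :: "(nat \<Rightarrow> bool) \<Rightarrow> real"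
  assumes d: "d \<ge> 1"
    and indep: "indep_vars (\<lambda>_. count_space UNIV) X {1..d}"
    and p: "\<And>i. i \<in> {1..d} \<Longrightarrow> p i \<in> {0..1}"
    and bern: "\<And>i. i \<in> {1..d} \<Longrightarrow>
      distr M (count_space UNIV) (X i) = measure_pmf (bernoulli_pmf (p i))"
  shows expectation_realization: "(\<integral>\<omega>. f (realization d X \<omega>) \<partial>M) = bernE {1..d} p f"
    and measurable_realization: "(\<lambda>\<omega>. f (realization d X \<omega>)) \<in> borel_measurable M"
proof -
  let ?\<Omega> = "PiE {1..d} (\<lambda>_. UNIV :: bool set)"
  let ?w = "\<lambda>x. \<Prod>i\<in>{1..d}. if x i then p i else 1 - p i"
  define E where "E x = {\<omega>\<in>space M. realization d X \<omega> = x}" for x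
  have meas: "X i \<in> measurable M (count_space UNIV)" if "i \<in> {1..d}" for i
    using indep that by (auto simp: indep_vars_def)
  have E_eq: "E x = (\<Inter>i\<in>{1..d}. X i -` {x i} \<inter> space M)" if "x \<in> ?\<Omega>" for x
  proof (intro set_eqI iffI)
    fix \<omega> assume "\<omega> \<in> E x"
    then show "\<omega> \<in> (\<Inter>i\<in>{1..d}. X i -` {x i} \<inter> space M)"
      by (auto simp: E_def realization_def)
  next
    fix \<omega> assume *: "\<omega> \<in> (\<Inter>i\<in>{1..d}. X i -` {x i} \<inter> space M)"
    then have "\<omega> \<in> space M" using d by (auto simp: Ball_def)
    moreover have "realization d X \<omega> = x"
      using that * by (auto simp: realization_def PiE_def extensional_def fun_eq_iff restrict_def)
    ultimately show "\<omega> \<in> E x" by (simp add: E_def)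
  qed
  have E_sets: "E x \<in> sets M" if "x \<in> ?\<Omega>" for x
    unfolding E_eq[OF that] using d by (intro sets.finite_INT measurable_sets[OF meas]) auto
  have E_prob: "prob (E x) = ?w x" if "x \<in> ?\<Omega>" for x
  proof -
    have "prob (E x) = (\<Prod>i\<in>{1..d}. prob (X i -` {x i} \<inter> space M))"
      unfolding E_eq[OF that] by (rule indep_varsD[OF indep]) (use d in auto)
    also have "\<dots> = ?w x"
    proof (rule prod.cong[OF refl])
      fix i assume i: "i \<in> {1..d}"
      have "prob (X i -` {x i} \<inter> space M) = measure (distr M (count_space UNIV) (X i)) {x i}"
        by (rule measure_distr[symmetric]) (use meas[OF i] in auto)
      also have "\<dots> = (if x i then p i else 1 - p i)"
        unfolding bern[OF i] measure_pmf_single using p[OF i] by auto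
      finally show "prob (X i -` {x i} \<inter> space M) = (if x i then p i else 1 - p i)" .
    qed
    finally show ?thesis .
  qed
  have fin: "finite ?\<Omega>" by (auto intro: finite_PiE)
  have eq: "f (realization d X \<omega>) = (\<Sum>x\<in>?\<Omega>. f x * indicator (E x) \<omega>)" if "\<omega> \<in> space M" for \<omega>
  proof -
    have "realization d X \<omega> \<in> ?\<Omega>" by (auto simp: realization_def)
    then show ?thesis
      using fin that by (simp add: E_def indicator_def sum.delta' if_distrib cong: if_cong)
  qed
  show "(\<lambda>\<omega>. f (realization d X \<omega>)) \<in> borel_measurable M"
  proof (subst measurable_cong[OF eq])
    show "(\<lambda>\<omega>. \<Sum>x\<in>?\<Omega>. f x * indicator (E x) \<omega>) \<in> borel_measurable M"
      by (intro borel_measurable_sum borel_measurable_times borel_measurable_const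
          borel_measurable_indicator E_sets)
  qed
  have "(\<integral>\<omega>. f (realization d X \<omega>) \<partial>M) = (\<integral>\<omega>. (\<Sum>x\<in>?\<Omega>. f x * indicator (E x) \<omega>) \<partial>M)"
    by (rule Bochner_Integration.integral_cong[OF refl]) (rule eq)
  also have "\<dots> = (\<Sum>x\<in>?\<Omega>. \<integral>\<omega>. f x * indicator (E x) \<omega> \<partial>M)"
    by (intro Bochner_Integration.integral_sum integrable_mult_right integrable_real_indicator E_sets)
      (simp_all add: emeasure_eq_measure)
  also have "\<dots> = (\<Sum>x\<in>?\<Omega>. f x * prob (E x))"
  proof (rule sum.cong[OF refl])
    fix x assume "x \<in> ?\<Omega>"
    then have "E x \<inter> space M = E x" using E_sets sets.sets_into_space by blast
    then show "(\<integral>\<omega>. f x * indicator (E x) \<omega> \<partial>M) = f x * prob (E x)" by simp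
  qed
  also have "\<dots> = bernE {1..d} p f"
    by (simp add: bernE_def E_prob mult.commute)
  finally show "(\<integral>\<omega>. f (realization d X \<omega>) \<partial>M) = bernE {1..d} p f" .
qed

lemma integral_uniform_measure:
  fixes g :: "'a \<Rightarrow> real"
  assumes A: "A \<in> sets M" and g: "g \<in> borel_measurable M"
  shows "(\<integral>\<omega>. g \<omega> \<partial>uniform_measure M A) = (\<integral>\<omega>. indicator A \<omega> * g \<omega> \<partial>M) / prob A"
proof (cases "prob A = 0")
  case True
  then have "A \<in> null_sets M" by (intro null_setsI A) (simp add: emeasure_eq_measure)
  then have "AE \<omega> in M. \<omega> \<notin> A" by (rule AE_not_in)
  then have "AE \<omega> in uniform_measure M A. g \<omega> = 0"
    by (intro AE_uniform_measureI[OF A]) (erule AE_mp, rule AE_I2, blast)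
  then have "(\<integral>\<omega>. g \<omega> \<partial>uniform_measure M A) = 0"
    by (rule integral_eq_zero_AE)
  then show ?thesis using True by simp
next
  case False
  have "uniform_measure M A = density M (\<lambda>x. ennreal (indicator A x / prob A))"
    unfolding uniform_measure_def
  proof (rule arg_cong[where f = "density M"], rule ext)
    fix x show "indicator A x / emeasure M A = ennreal (indicator A x / prob A)"
      using False divide_ennreal[of 1 "prob A"] zero_less_measure_iff[of M A]
      by (cases "x \<in> A") (simp_all add: emeasure_eq_measure)
  qed
  also have "(\<integral>\<omega>. g \<omega> \<partial>\<dots>) = (\<integral>\<omega>. (indicator A \<omega> * g \<omega>) / prob A \<partial>M)"
    using A g by (subst integral_density) auto
  finally show ?thesis by simp
qed

lemma posterior_mean_uniform_measure:
  fixes X :: "nat \<Rightarrow> 'a \<Rightarrow> bool"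
  assumes d: "d \<ge> 1"
    and indep: "indep_vars (\<lambda>_. count_space UNIV) X {1..d}"
    and p: "\<And>i. i \<in> {1..d} \<Longrightarrow> p i \<in> {0..1}"
    and bern: "\<And>i. i \<in> {1..d} \<Longrightarrow>
      distr M (count_space UNIV) (X i) = measure_pmf (bernoulli_pmf (p i))"
    and i: "i \<in> {1..d}"
  shows "posterior_mean X (uniform_measure M {\<omega>\<in>space M. realization d X \<omega> \<in> S}) i
     = cond_mean {1..d} p S (\<lambda>x. of_bool (x i))"
proof -
  note E = expectation_realization[OF d indep p bern]
  note meas = measurable_realization[OF d indep p bern]
  let ?B = "{\<omega>\<in>space M. realization d X \<omega> \<in> S}"
  have Xi: "of_bool (X i \<omega>) = (of_bool (realization d X \<omega> i) :: real)" for \<omega>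
    using i by (simp add: realization_def)
  have "(\<lambda>\<omega>. of_bool (realization d X \<omega> \<in> S) :: real) \<in> borel_measurable M" by (rule meas)
  then have "(\<lambda>\<omega>. of_bool (realization d X \<omega> \<in> S) :: real) -` {1} \<inter> space M \<in> sets M"
    by (rule measurable_sets) simp
  also have "(\<lambda>\<omega>. of_bool (realization d X \<omega> \<in> S) :: real) -` {1} \<inter> space M = ?B" by auto
  finally have B: "?B \<in> sets M" .
  have ind: "indicator ?B \<omega> = (of_bool (realization d X \<omega> \<in> S) :: real)" if "\<omega> \<in> space M" for \<omega>
    using that by (simp add: indicator_def)
  have Xi_meas: "(\<lambda>\<omega>. of_bool (realization d X \<omega> i) :: real) \<in> borel_measurable M" by (rule meas)
  have "prob ?B = (\<integral>\<omega>. indicator ?B \<omega> \<partial>M)" using B by simp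
  also have "\<dots> = (\<integral>\<omega>. of_bool (realization d X \<omega> \<in> S) \<partial>M)"
    by (rule Bochner_Integration.integral_cong[OF refl]) (rule ind)
  also have "\<dots> = bernE {1..d} p (\<lambda>x. of_bool (x \<in> S))" by (rule E)
  finally have P: "prob ?B = bernE {1..d} p (\<lambda>x. of_bool (x \<in> S))" .
  have "(\<integral>\<omega>. indicator ?B \<omega> * of_bool (realization d X \<omega> i) \<partial>M)
     = (\<integral>\<omega>. of_bool (realization d X \<omega> \<in> S) * of_bool (realization d X \<omega> i) \<partial>M)"
    by (rule Bochner_Integration.integral_cong[OF refl]) (simp add: indicator_def)
  also have "\<dots> = bernE {1..d} p (\<lambda>x. of_bool (x \<in> S) * of_bool (x i))" by (rule E)
  finally show ?thesis
    unfolding posterior_mean_def Xi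
    unfolding integral_uniform_measure[OF B Xi_meas] cond_mean_def P
    by (rule arg_cong[where f = "\<lambda>t. t / _"])
qed

end

section \<open>Risks as finite sums\<close>

context prob_space
begin

lemma
  fixes X :: "nat \<Rightarrow> 'a \<Rightarrow> bool" and \<sigma> :: "(nat \<Rightarrow> bool) \<Rightarrow> nat set"
  assumes d: "d \<ge> 1"
    and indep: "indep_vars (\<lambda>_. count_space UNIV) X {1..d}"
    and p: "\<And>i. i \<in> {1..d} \<Longrightarrow> p i \<in> {0..1}"
    and bern: "\<And>i. i \<in> {1..d} \<Longrightarrow>
      distr M (count_space UNIV) (X i) = measure_pmf (bernoulli_pmf (p i))"
    and \<sigma>: "\<And>x. \<sigma> x \<subseteq> {1..d}"
  shows naive_risk_eq: "naive_risk d M X \<sigma> =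
      bernE {1..d} p (\<lambda>x. \<Sum>i\<in>{1..d} - \<sigma> x. (p i - of_bool (x i))\<^sup>2) / d"
    and sophisticated_risk_eq: "sophisticated_risk d M X \<sigma> =
      bernE {1..d} p (\<lambda>x. \<Sum>i\<in>{1..d}.
        (cond_mean {1..d} p {y. (\<sigma> y, restrict y (\<sigma> y)) = (\<sigma> x, restrict x (\<sigma> x))}
           (\<lambda>y. of_bool (y i)) - of_bool (x i))\<^sup>2) / d"
proof -
  let ?R = "realization d X"
  note E = expectation_realization[OF d indep p bern]
  note post = posterior_mean_uniform_measure[OF d indep p bern]
  have R: "X i \<omega> = ?R \<omega> i" if "i \<in> {1..d}" for i \<omega>
    using that by (simp add: realization_def)
  define C :: "(nat \<Rightarrow> bool) \<Rightarrow> (nat \<Rightarrow> bool) set" where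
    "C x = {y. (\<sigma> y, restrict y (\<sigma> y)) = (\<sigma> x, restrict x (\<sigma> x))}" for x
  have naive_set: "{\<omega>' \<in> space M. \<forall>i\<in>\<sigma> (?R \<omega>). X i \<omega>' = X i \<omega>}
      = {\<omega>' \<in> space M. ?R \<omega>' \<in> {y. \<forall>i\<in>\<sigma> (?R \<omega>). y i = ?R \<omega> i}}" for \<omega>
    using \<sigma>[of "?R \<omega>"] by (auto simp: R subset_iff)
  have "{\<omega>' \<in> space M. (\<forall>i\<in>\<sigma> (?R \<omega>). X i \<omega>' = X i \<omega>) \<and> \<sigma> (?R \<omega>') = \<sigma> (?R \<omega>)}
      = {\<omega>' \<in> space M. ?R \<omega>' \<in> {y. (\<forall>i\<in>\<sigma> (?R \<omega>). y i = ?R \<omega> i) \<and> \<sigma> y = \<sigma> (?R \<omega>)}}" for \<omega>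
    using \<sigma>[of "?R \<omega>"] by (auto simp: R subset_iff)
  moreover have "{y. (\<forall>i\<in>\<sigma> x. y i = x i) \<and> \<sigma> y = \<sigma> x}
      = C x" for x
    unfolding C_def by (auto simp: fun_eq_iff restrict_def)
  ultimately have soph_set:
    "{\<omega>' \<in> space M. (\<forall>i\<in>\<sigma> (?R \<omega>). X i \<omega>' = X i \<omega>) \<and> \<sigma> (?R \<omega>') = \<sigma> (?R \<omega>)}
      = {\<omega>' \<in> space M. ?R \<omega>' \<in> C (?R \<omega>)}" for \<omega>
    by simp
  show "sophisticated_risk d M X \<sigma> =
      bernE {1..d} p (\<lambda>x. \<Sum>i\<in>{1..d}.
        (cond_mean {1..d} p {y. (\<sigma> y, restrict y (\<sigma> y)) = (\<sigma> x, restrict x (\<sigma> x))}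
           (\<lambda>y. of_bool (y i)) - of_bool (x i))\<^sup>2) / d"
    unfolding sophisticated_risk_def recovery_loss_def sophisticated_posterior_def Let_def soph_set
      C_def[symmetric]
    by (subst E[symmetric], assumption) (simp only: post cong: sum.cong)
  have "naive_risk d M X \<sigma> = bernE {1..d} p (\<lambda>x. \<Sum>i\<in>{1..d}.
        (cond_mean {1..d} p {y. \<forall>i\<in>\<sigma> x. y i = x i} (\<lambda>y. of_bool (y i)) - of_bool (x i))\<^sup>2) / d"
    unfolding naive_risk_def recovery_loss_def naive_posterior_def Let_def naive_set
    by (subst E[symmetric], assumption) (simp only: post cong: sum.cong)
  also have "bernE {1..d} p (\<lambda>x. \<Sum>i\<in>{1..d}.
        (cond_mean {1..d} p {y. \<forall>i\<in>\<sigma> x. y i = x i} (\<lambda>y. of_bool (y i)) - of_bool (x i))\<^sup>2)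
      = bernE {1..d} p (\<lambda>x. \<Sum>i\<in>{1..d} - \<sigma> x. (p i - of_bool (x i))\<^sup>2)"
  proof (rule bernE_cong_pos)
    fix x assume x: "x \<in> PiE {1..d} (\<lambda>_. UNIV :: bool set)"
      and pos: "(\<Prod>i\<in>{1..d}. if x i then p i else 1 - p i) \<noteq> 0"
    let ?S = "{y. \<forall>i\<in>\<sigma> x. y i = x i}"
    have "cond_mean {1..d} p ?S (\<lambda>y. of_bool (y i)) = of_bool (x i)" if "i \<in> \<sigma> x" for i
      by (rule cond_mean_observed[OF _ p x _ pos]) (use that in auto)
    moreover have "cond_mean {1..d} p ?S (\<lambda>y. of_bool (y i)) = p i" if "i \<in> {1..d} - \<sigma> x" for i
      by (rule cond_mean_unobserved[OF _ p x _ pos]) (use that in auto)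
    ultimately show "(\<Sum>i\<in>{1..d}. (cond_mean {1..d} p ?S (\<lambda>y. of_bool (y i)) - of_bool (x i))\<^sup>2)
        = (\<Sum>i\<in>{1..d} - \<sigma> x. (p i - of_bool (x i))\<^sup>2)"
      by (subst sum.subset_diff[OF \<sigma>[of x]]) simp_all
  qed
  finally show "naive_risk d M X \<sigma> =
      bernE {1..d} p (\<lambda>x. \<Sum>i\<in>{1..d} - \<sigma> x. (p i - of_bool (x i))\<^sup>2) / d" .
qed

end

section \<open>The greedy set\<close>

lemma card_rank_le:
  fixes r :: "'i \<Rightarrow> nat"
  assumes "finite A" "inj_on r A" "r ` A \<subseteq> {1..card A}"
  shows "card {j \<in> A. r j \<le> k} = min k (card A)"
proof -
  have "r ` A = {1..card A}"
    using assms by (intro card_subset_eq) (auto simp: card_image)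
  then have "r ` {j \<in> A. r j \<le> k} = {1..min k (card A)}"
    by (auto simp: image_iff set_eq_iff) (metis)+
  then show ?thesis
    using card_image[of r "{j \<in> A. r j \<le> k}"] assms(2) by (simp add: inj_on_def)
qed

lemma
  fixes A :: "nat set"
  assumes fin: "finite A"
  shows card_first: "card {j \<in> A. card {i \<in> A. i \<le> j} \<le> k} = min k (card A)"
    and card_last: "card {j \<in> A. card {i \<in> A. j \<le> i} \<le> k} = min k (card A)"
proof -
  have rank: "card {i \<in> A. P i j} \<in> {1..card A}" if "j \<in> A" "P j j" for P :: "nat \<Rightarrow> nat \<Rightarrow> bool" and j
    using that fin card_mono[of A "{i \<in> A. P i j}"] by (auto simp: Suc_le_eq card_gt_0_iff)
  have "inj_on (\<lambda>j. card {i \<in> A. i \<le> j}) A"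
  proof (rule linorder_inj_onI')
    fix i j assume "i \<in> A" "j \<in> A" "i < j"
    then have "{l \<in> A. l \<le> i} \<subset> {l \<in> A. l \<le> j}" by force
    then show "card {l \<in> A. l \<le> i} \<noteq> card {l \<in> A. l \<le> j}"
      using fin psubset_card_mono[of "{l \<in> A. l \<le> j}" "{l \<in> A. l \<le> i}"] by simp
  qed
  then show "card {j \<in> A. card {i \<in> A. i \<le> j} \<le> k} = min k (card A)"
    using fin rank[of _ "(\<le>)"] by (intro card_rank_le) auto
  have "inj_on (\<lambda>j. card {i \<in> A. j \<le> i}) A"
  proof (rule linorder_inj_onI')
    fix i j assume "i \<in> A" "j \<in> A" "i < j"
    then have "i \<in> {l \<in> A. i \<le> l}" "i \<notin> {l \<in> A. j \<le> l}"
      "{l \<in> A. j \<le> l} \<subseteq> {l \<in> A. i \<le> l}" by auto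
    then have "{l \<in> A. j \<le> l} \<subset> {l \<in> A. i \<le> l}" by blast
    then show "card {l \<in> A. i \<le> l} \<noteq> card {l \<in> A. j \<le> l}"
      using fin psubset_card_mono[of "{l \<in> A. i \<le> l}" "{l \<in> A. j \<le> l}"] by simp
  qed
  then show "card {j \<in> A. card {i \<in> A. j \<le> i} \<le> k} = min k (card A)"
    using fin rank[of _ "(\<lambda>i j. j \<le> i)"] by (intro card_rank_le) auto
qed

definition ones :: "nat \<Rightarrow> (nat \<Rightarrow> bool) \<Rightarrow> nat set" where
  "ones b y = {j \<in> {1..b}. y j}"

definition greedy_positions :: "nat \<Rightarrow> nat \<Rightarrow> (nat \<Rightarrow> bool) \<Rightarrow> nat set" where
  "greedy_positions d k y =
     {j \<in> ones d y. card (ones j y) \<le> k} \<union>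
     {j \<in> ones d (\<lambda>i. \<not> y i). card {i \<in> ones d (\<lambda>i. \<not> y i). j \<le> i} \<le> k - card (ones d y)}"

lemma finite_ones [simp]: "finite (ones b y)"
  by (simp add: ones_def)

lemma ones_mono: "b \<le> d \<Longrightarrow> ones b y \<subseteq> ones d y"
  by (auto simp: ones_def)

lemma ones_le: "j \<in> ones d y \<Longrightarrow> {i \<in> ones d y. i \<le> j} = ones j y"
  by (auto simp: ones_def)

lemma greedy_eq: "greedy d p \<pi> k x = \<pi> ` greedy_positions d k (\<lambda>j. xstar p x (\<pi> j))"
proof -
  have "{j \<in> ones d y. card {i \<in> ones d y. i \<le> j} \<le> k} = {j \<in> ones d y. card (ones j y) \<le> k}" for y
    by (auto simp: ones_le)
  then show ?thesis
    unfolding greedy_def Let_def ones_def[symmetric] greedy_positions_def by simp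
qed

lemma greedy_positions_subset: "greedy_positions d k y \<subseteq> {1..d}"
  by (auto simp: greedy_positions_def ones_def)

lemma card_first_ones: "card {j \<in> ones d y. card (ones j y) \<le> k} = min k (card (ones d y))"
proof -
  have "{j \<in> ones d y. card (ones j y) \<le> k} = {j \<in> ones d y. card {i \<in> ones d y. i \<le> j} \<le> k}"
    by (auto simp: ones_le)
  then show ?thesis by (simp add: card_first)
qed

lemma card_greedy_positions_le: "card (greedy_positions d k y) \<le> k"
proof -
  have "card (greedy_positions d k y) \<le> min k (card (ones d y)) + (k - card (ones d y))"
    unfolding greedy_positions_def
    by (rule order_trans[OF card_Un_le add_mono]) (simp_all add: card_first_ones card_last)
  then show ?thesis by simp
qed

lemma greedy_positions_saturated:
  assumes "b \<le> d" "k \<le> card (ones b y)"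
  shows "greedy_positions d k y = {j \<in> ones b y. card (ones j y) \<le> k}"
proof -
  have "card (ones b y) \<le> card (ones d y)"
    using assms by (intro card_mono ones_mono finite_ones) simp
  moreover have "card {i \<in> ones d (\<lambda>i. \<not> y i). j \<le> i} \<noteq> 0" if "j \<in> ones d (\<lambda>i. \<not> y i)" for j
    using that by auto
  ultimately have "greedy_positions d k y = {j \<in> ones d y. card (ones j y) \<le> k}"
    using assms by (auto simp: greedy_positions_def)
  moreover have "card (ones j y) > k" if "j \<in> ones d y" "j \<notin> ones b y" for j
  proof -
    have "insert j (ones b y) \<subseteq> ones j y" using that by (auto simp: ones_def)
    then have "card (insert j (ones b y)) \<le> card (ones j y)" by (rule card_mono[rotated]) simp
    then show ?thesis using that assms by simp
  qed
  ultimately show ?thesis using ones_mono[OF assms(1)] by fastforce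
qed

lemma card_sym_diff_greedy:
  assumes "b \<le> d"
  shows "real (card (sym_diff (greedy_positions d k y) (ones b y))) \<le> \<bar>real k - real (card (ones b y))\<bar>"
proof (cases "k \<le> card (ones b y)")
  case True
  let ?G = "greedy_positions d k y"
  note G = greedy_positions_saturated[OF assms True]
  have "card ?G = k" unfolding G card_first_ones using True by simp
  moreover have "?G \<subseteq> ones b y" unfolding G by auto
  moreover from this have "sym_diff ?G (ones b y) = ones b y - ?G" by auto
  ultimately show ?thesis
    by (simp add: card_Diff_subset finite_subset[OF _ finite_ones] of_nat_diff)
next
  case False
  let ?G = "greedy_positions d k y"
  have sub: "ones b y \<subseteq> ?G"
  proof
    fix j assume j: "j \<in> ones b y"
    then have "card (ones j y) \<le> card (ones b y)"
      by (intro card_mono ones_mono finite_ones) (simp add: ones_def)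
    then show "j \<in> ?G"
      using j False ones_mono[OF assms, of y] by (auto simp: greedy_positions_def)
  qed
  then have "sym_diff ?G (ones b y) = ?G - ones b y" by auto
  then show ?thesis
    using card_greedy_positions_le[of d k y] False sub by (simp add: card_Diff_subset)
qed

lemma card_unsaturated_ones:
  assumes "b \<le> d"
  shows "real (card {j \<in> {b<..d}. y j \<and> card (ones (j - 1) y) < k}) \<le> \<bar>real k - real (card (ones b y))\<bar>"
proof (cases "k \<le> card (ones b y)")
  case True
  have "card (ones b y) \<le> card (ones (j - 1) y)" if "b < j" for j
    using that by (intro card_mono ones_mono finite_ones) simp
  then have "{j \<in> {b<..d}. y j \<and> card (ones (j - 1) y) < k} = {}"
    using True by fastforce
  then show ?thesis by (simp only: card.empty)
next
  case False
  let ?S = "{j \<in> {b<..d}. y j \<and> card (ones (j - 1) y) < k}"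
  have "card (ones j y) \<le> card (insert j (ones (j - 1) y))" for j
    by (rule card_mono) (auto simp: ones_def)
  then have step: "card (ones j y) \<le> Suc (card (ones (j - 1) y))" for j
    using order_trans card_insert_le_m1 le_SucI by (metis card_insert_if finite_ones order_refl)
  have "?S \<subseteq> {j \<in> ones d y. card (ones j y) \<le> k}"
  proof (intro subsetI)
    fix j assume "j \<in> ?S"
    then have "j \<in> ones d y" "card (ones (j - 1) y) < k" by (simp_all add: ones_def)
    then show "j \<in> {j \<in> ones d y. card (ones j y) \<le> k}"
      using step[of j] by (intro CollectI conjI) (assumption | linarith)+
  qed
  moreover have "card (ones j y) \<le> card (ones b y)" if "j \<in> ones b y" for j
    using that by (intro card_mono ones_mono finite_ones) (simp add: ones_def)
  then have "ones b y \<subseteq> {j \<in> ones d y. card (ones j y) \<le> k}"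
    using False ones_mono[OF assms, of y] by fastforce
  ultimately have "card (?S \<union> ones b y) \<le> card {j \<in> ones d y. card (ones j y) \<le> k}"
    by (intro card_mono) auto
  also have "\<dots> \<le> k" by (simp add: card_first_ones)
  also have "card (?S \<union> ones b y) = card ?S + card (ones b y)"
    by (rule card_Un_disjoint) (auto simp: ones_def)
  finally show ?thesis by simp
qed

section \<open>Finite-dimensional risk bounds\<close>

lemma pstar_le_half: "pstar p i \<le> 1/2"
  by (simp add: pstar_def min_def)

lemma pstar_range: "p i \<in> {0..1} \<Longrightarrow> pstar p i \<in> {0..1}"
  by (auto simp: pstar_def)

lemma sq_error_star: "(p i - of_bool (x i))\<^sup>2 = (pstar p i - of_bool (xstar p x i))\<^sup>2"
  by (auto simp: pstar_def xstar_def power2_eq_square algebra_simps)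

lemma card_ones_eq_sum: "real (card (ones b y)) = (\<Sum>j=1..b. of_bool (y j))"
  unfolding ones_def by (simp add: of_bool_def sum.If_cases Int_def)

lemma sum_Diff_close:
  fixes c :: "'i \<Rightarrow> real"
  assumes "finite A" "G \<subseteq> A" "H \<subseteq> A" "\<And>j. j \<in> A \<Longrightarrow> 0 \<le> c j \<and> c j \<le> 1"
  shows "\<bar>(\<Sum>j\<in>A - G. c j) - (\<Sum>j\<in>A - H. c j)\<bar> \<le> card (sym_diff G H)"
proof -
  have *: "(\<Sum>j\<in>A - K. c j) = (\<Sum>j\<in>A. of_bool (j \<notin> K) * c j)" for K
    using assms(1) by (intro sum.mono_neutral_cong_left) auto
  have "\<bar>(\<Sum>j\<in>A - G. c j) - (\<Sum>j\<in>A - H. c j)\<bar>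
      = \<bar>\<Sum>j\<in>A. of_bool (j \<notin> G) * c j - of_bool (j \<notin> H) * c j\<bar>"
    unfolding * sum_subtractf ..
  also have "\<dots> \<le> (\<Sum>j\<in>A. \<bar>of_bool (j \<notin> G) * c j - of_bool (j \<notin> H) * c j\<bar>)"
    by (rule sum_abs)
  also have "\<dots> \<le> (\<Sum>j\<in>A. of_bool (j \<in> sym_diff G H))"
    using assms(4) by (intro sum_mono) (fastforce split: if_splits)
  also have "\<dots> = card (sym_diff G H)"
    using assms(1-3) by (subst sum_of_bool_eq) (auto intro!: arg_cong[where f = card])
  finally show ?thesis .
qed

locale ordered_bernoulli =
  fixes d :: nat and p :: "nat \<Rightarrow> real" and \<pi> :: "nat \<Rightarrow> nat"
  assumes p_range: "i \<in> {1..d} \<Longrightarrow> p i \<in> {0..1}"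
    and ordering: "pstar_ordering d p \<pi>"
begin

abbreviation E :: "((nat \<Rightarrow> bool) \<Rightarrow> real) \<Rightarrow> real" where
  "E \<equiv> bernE {1..d} p"

text \<open>In the paper's notation, \<open>q j\<close> is \<open>p\<^sup>*\<close> and \<open>s x j\<close> is \<open>X\<^sup>*\<close> at the ordered index \<open>(j)\<close>.\<close>

definition q :: "nat \<Rightarrow> real" where
  "q j = pstar p (\<pi> j)"

definition s :: "(nat \<Rightarrow> bool) \<Rightarrow> nat \<Rightarrow> bool" where
  "s x = (\<lambda>j. xstar p x (\<pi> j))"

lemma bij: "bij_betw \<pi> {1..d} {1..d}"
  using ordering by (simp add: pstar_ordering_def)

lemma \<pi>_in: "j \<in> {1..d} \<Longrightarrow> \<pi> j \<in> {1..d}"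
  using bij by (rule bij_betwE[rule_format])

lemma \<pi>_eq_iff: "i \<in> {1..d} \<Longrightarrow> j \<in> {1..d} \<Longrightarrow> \<pi> i = \<pi> j \<longleftrightarrow> i = j"
  using bij by (auto simp: bij_betw_def inj_on_eq_iff)

lemma q_range: "j \<in> {1..d} \<Longrightarrow> 0 \<le> q j \<and> q j \<le> 1/2"
  unfolding q_def
  using pstar_range[of p "\<pi> j"] p_range[OF \<pi>_in[of j]] pstar_le_half[of p "\<pi> j"] by simp

lemma E_mono: "(\<And>x. f x \<le> g x) \<Longrightarrow> E f \<le> E g"
  by (rule bernE_mono[OF p_range])

lemma s_upd:
  assumes "i \<in> {1..d}" "j \<in> {1..d}"
  shows "s (x(\<pi> j := c)) i = (if i = j then c = (p (\<pi> j) \<le> 1/2) else s x i)"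
  using \<pi>_eq_iff[OF assms] by (auto simp: s_def xstar_def)

lemma ones_upd:
  assumes "l < j" "j \<in> {1..d}"
  shows "ones l (s (x(\<pi> j := c))) = ones l (s x)"
  using assms s_upd[OF _ assms(2)] by (auto simp: ones_def)

lemma resample:
  assumes "j \<in> {1..d}"
  shows "E f = E (\<lambda>x. q j * f (x(\<pi> j := (p (\<pi> j) \<le> 1/2))) + (1 - q j) * f (x(\<pi> j := (\<not> p (\<pi> j) \<le> 1/2))))"
proof (cases "p (\<pi> j) \<le> 1/2")
  case True
  then show ?thesis
    by (subst bernE_resample[OF _ \<pi>_in[OF assms]]) (auto simp: q_def pstar_def min_def)
next
  case False
  then show ?thesis
    by (subst bernE_resample[OF _ \<pi>_in[OF assms]]) (auto simp: q_def pstar_def min_def algebra_simps)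
qed

lemma E_marginal: "j \<in> {1..d} \<Longrightarrow> E (\<lambda>x. f (s x j)) = q j * f True + (1 - q j) * f False"
  by (subst resample, assumption) (simp add: s_upd bernE_const)

lemma E_sq_error: "j \<in> {1..d} \<Longrightarrow> E (\<lambda>x. (q j - of_bool (s x j))\<^sup>2) = q j * (1 - q j)"
  by (subst E_marginal[where f = "\<lambda>b. (q j - of_bool b)\<^sup>2"])
    (simp_all add: power2_eq_square algebra_simps)

lemma E_centered_sq:
  "b \<le> d \<Longrightarrow> E (\<lambda>x. (real (card (ones b (s x))) - (\<Sum>j=1..b. q j))\<^sup>2) \<le> b"
proof (induction b)
  case 0
  then show ?case by (simp add: ones_def bernE_const)
next
  case (Suc b)
  define Z where "Z x = real (card (ones b (s x))) - (\<Sum>j=1..b. q j)" for x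
  let ?j = "Suc b"
  have j: "?j \<in> {1..d}" using Suc.prems by simp
  have Z_upd: "Z (x(\<pi> ?j := c)) = Z x" for x c
    by (simp add: Z_def ones_upd[OF _ j])
  have "E (\<lambda>x. (real (card (ones ?j (s x))) - (\<Sum>j=1..?j. q j))\<^sup>2)
      = E (\<lambda>x. (Z x + of_bool (s x ?j) - q ?j)\<^sup>2)"
    by (rule bernE_cong) (simp add: Z_def card_ones_eq_sum algebra_simps)
  also have "\<dots> = E (\<lambda>x. q ?j * (Z x + 1 - q ?j)\<^sup>2 + (1 - q ?j) * (Z x - q ?j)\<^sup>2)"
    by (subst resample[OF j]) (simp add: Z_upd s_upd[OF j j])
  also have "\<dots> = E (\<lambda>x. (Z x)\<^sup>2 + q ?j * (1 - q ?j))"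
    by (rule bernE_cong) (simp add: power2_eq_square algebra_simps)
  also have "\<dots> = E (\<lambda>x. (Z x)\<^sup>2) + q ?j * (1 - q ?j)"
    by (simp add: bernE_add bernE_const)
  also have "\<dots> \<le> real b + 1"
    using q_range[OF j] mult_le_one[of "q ?j" "1 - q ?j"] Suc
    unfolding Z_def by (intro add_mono) simp_all
  finally show ?case by simp
qed

lemma E_abs_dev:
  assumes "b \<le> d" "d \<ge> 1"
  shows "E (\<lambda>x. \<bar>real k - real (card (ones b (s x)))\<bar>) \<le> \<bar>real k - (\<Sum>j=1..b. q j)\<bar> + sqrt d"
proof -
  let ?Z = "\<lambda>x. real (card (ones b (s x))) - (\<Sum>j=1..b. q j)"
  have sd: "sqrt d > 0" using assms by simp
  have amgm: "\<bar>z\<bar> \<le> (1 / (2 * sqrt d)) * z\<^sup>2 + sqrt d / 2" for z :: real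
  proof -
    have "0 \<le> (\<bar>z\<bar> - sqrt d)\<^sup>2" by simp
    then have "2 * sqrt d * \<bar>z\<bar> \<le> z\<^sup>2 + sqrt d * sqrt d"
      by (simp add: power2_diff power2_eq_square algebra_simps)
    then show ?thesis using sd by (simp add: field_simps power2_eq_square)
  qed
  have "E (\<lambda>x. \<bar>real k - real (card (ones b (s x)))\<bar>)
      \<le> E (\<lambda>x. \<bar>real k - (\<Sum>j=1..b. q j)\<bar> + ((1 / (2 * sqrt d)) * (?Z x)\<^sup>2 + sqrt d / 2))"
  proof (rule E_mono)
    fix x show "\<bar>real k - real (card (ones b (s x)))\<bar>
        \<le> \<bar>real k - (\<Sum>j=1..b. q j)\<bar> + ((1 / (2 * sqrt d)) * (?Z x)\<^sup>2 + sqrt d / 2)"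
      using amgm[of "?Z x"] by linarith
  qed
  also have "\<dots> = \<bar>real k - (\<Sum>j=1..b. q j)\<bar> + ((1 / (2 * sqrt d)) * E (\<lambda>x. (?Z x)\<^sup>2) + sqrt d / 2)"
    by (simp only: bernE_add bernE_cmult bernE_const finite_atLeastAtMost)
  also have "(1 / (2 * sqrt d)) * E (\<lambda>x. (?Z x)\<^sup>2) \<le> (1 / (2 * sqrt d)) * d"
    using E_centered_sq[OF assms(1)] assms sd by (intro mult_left_mono) auto
  also have "(1 / (2 * sqrt d)) * d = sqrt d / 2"
    using sd by (simp add: field_simps)
  finally show ?thesis by simp
qed

definition G :: "nat \<Rightarrow> (nat \<Rightarrow> bool) \<Rightarrow> nat set" where
  "G k x = greedy_positions d k (s x)"

lemma greedy_G: "greedy d p \<pi> k x = \<pi> ` G k x"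
  by (simp add: greedy_eq G_def s_def)

lemma G_subset: "G k x \<subseteq> {1..d}"
  unfolding G_def by (rule greedy_positions_subset)

lemma greedy_subset: "greedy d p \<pi> k x \<subseteq> {1..d}"
  unfolding greedy_G using G_subset \<pi>_in by blast

lemma in_greedy_iff: "j \<in> {1..d} \<Longrightarrow> \<pi> j \<in> greedy d p \<pi> k x \<longleftrightarrow> j \<in> G k x"
  unfolding greedy_G using \<pi>_eq_iff G_subset by blast

lemma naive_loss_bound:
  assumes b: "b \<le> d"
  shows "\<bar>E (\<lambda>x. \<Sum>i\<in>{1..d} - greedy d p \<pi> k x. (p i - of_bool (x i))\<^sup>2)
      - ((\<Sum>j=1..b. (q j)\<^sup>2 * (1 - q j)) + (\<Sum>j\<in>{b<..d}. q j * (1 - q j)))\<bar>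
    \<le> E (\<lambda>x. \<bar>real k - real (card (ones b (s x)))\<bar>)"
proof -
  let ?c = "\<lambda>x j. (q j - of_bool (s x j))\<^sup>2"
  let ?O = "\<lambda>x. ones b (s x)"
  let ?L = "\<lambda>x. \<Sum>j\<in>{1..d} - G k x. ?c x j"
  let ?L' = "\<lambda>x. \<Sum>j\<in>{1..d} - ?O x. ?c x j"
  have L: "(\<Sum>i\<in>{1..d} - greedy d p \<pi> k x. (p i - of_bool (x i))\<^sup>2) = ?L x" for x
  proof -
    have inj: "inj_on \<pi> {1..d}" and im: "\<pi> ` {1..d} = {1..d}"
      using bij by (auto simp: bij_betw_def)
    have "{1..d} - greedy d p \<pi> k x = \<pi> ` ({1..d} - G k x)"
      unfolding greedy_G using inj_on_image_set_diff[OF inj _ G_subset] im by auto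
    then show ?thesis
      unfolding sq_error_star[of p _ x] q_def s_def
      by (simp only: sum.reindex[OF inj_on_subset[OF inj Diff_subset]] o_def)
  qed
  have close: "\<bar>?L x - ?L' x\<bar> \<le> \<bar>real k - real (card (?O x))\<bar>" for x
  proof -
    have "\<bar>?L x - ?L' x\<bar> \<le> card (sym_diff (G k x) (?O x))"
    proof (rule sum_Diff_close)
      show "?O x \<subseteq> {1..d}" using b by (auto simp: ones_def)
      show "0 \<le> ?c x j \<and> ?c x j \<le> 1" if "j \<in> {1..d}" for j
        using q_range[OF that] by (auto intro!: power_le_one simp: abs_square_le_1[symmetric] power2_commute)
    qed (rule finite_atLeastAtMost, rule G_subset)
    also have "\<dots> \<le> \<bar>real k - real (card (?O x))\<bar>"
      unfolding G_def by (rule card_sym_diff_greedy[OF b])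
    finally show ?thesis .
  qed
  have "?L' x = (\<Sum>j=1..b. of_bool (\<not> s x j) * (q j)\<^sup>2) + (\<Sum>j\<in>{b<..d}. ?c x j)" for x
  proof -
    have "?L' x = (\<Sum>j\<in>{1..b} - ?O x. ?c x j) + (\<Sum>j\<in>{b<..d}. ?c x j)"
      using b by (subst sum.union_disjoint[symmetric]) (auto simp: ones_def intro!: sum.cong)
    also have "(\<Sum>j\<in>{1..b} - ?O x. ?c x j) = (\<Sum>j=1..b. of_bool (\<not> s x j) * (q j)\<^sup>2)"
      by (rule sum.mono_neutral_cong_left) (auto simp: ones_def)
    finally show ?thesis .
  qed
  then have "E ?L' = (\<Sum>j=1..b. E (\<lambda>x. of_bool (\<not> s x j) * (q j)\<^sup>2)) + (\<Sum>j\<in>{b<..d}. E (\<lambda>x. ?c x j))"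
    by (simp only: bernE_add bernE_sum)
  also have "(\<Sum>j=1..b. E (\<lambda>x. of_bool (\<not> s x j) * (q j)\<^sup>2)) = (\<Sum>j=1..b. (q j)\<^sup>2 * (1 - q j))"
    using b by (intro sum.cong refl) (subst E_marginal[where f = "\<lambda>t. of_bool (\<not> t) * (q _)\<^sup>2"], auto)
  also have "(\<Sum>j\<in>{b<..d}. E (\<lambda>x. ?c x j)) = (\<Sum>j\<in>{b<..d}. q j * (1 - q j))"
    by (intro sum.cong refl E_sq_error) auto
  finally have EL': "E ?L' = (\<Sum>j=1..b. (q j)\<^sup>2 * (1 - q j)) + (\<Sum>j\<in>{b<..d}. q j * (1 - q j))" .
  have "E ?L - E ?L' \<le> E (\<lambda>x. \<bar>real k - real (card (?O x))\<bar>)"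
    unfolding bernE_diff[symmetric] by (rule E_mono) (rule close[THEN abs_le_D1])
  moreover have "E ?L' - E ?L \<le> E (\<lambda>x. \<bar>real k - real (card (?O x))\<bar>)"
    unfolding bernE_diff[symmetric]
    by (rule E_mono) (rule close[THEN abs_le_D2, unfolded minus_diff_eq])
  ultimately show ?thesis
    unfolding L EL' by linarith
qed

abbreviation obs :: "nat \<Rightarrow> (nat \<Rightarrow> bool) \<Rightarrow> nat set \<times> (nat \<Rightarrow> bool)" where
  "obs k x \<equiv> (greedy d p \<pi> k x, restrict x (greedy d p \<pi> k x))"

abbreviation pm :: "nat \<Rightarrow> (nat \<Rightarrow> bool) \<Rightarrow> nat \<Rightarrow> real" where
  "pm k x i \<equiv> cond_mean {1..d} p {y. obs k y = obs k x} (\<lambda>y. of_bool (y i))"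

lemma sophisticated_loss_upper:
  assumes b: "b \<le> d"
  shows "E (\<lambda>x. \<Sum>i\<in>{1..d}. (pm k x i - of_bool (x i))\<^sup>2)
    \<le> E (\<lambda>x. \<bar>real k - real (card (ones b (s x)))\<bar>) + (\<Sum>j\<in>{b<..d}. q j * (1 - q j))"
proof -
  \<comment> \<open>A suboptimal estimator: guess \<open>X\<^sup>* = 0\<close> at hidden positions up to \<open>b\<close>, and the prior beyond.\<close>
  define h where "h i x = (if i \<in> greedy d p \<pi> k x then of_bool (x i)
      else if i \<in> \<pi> ` {1..b} then of_bool (\<not> p i \<le> 1/2) else p i)" for i x
  have "E (\<lambda>x. \<Sum>i\<in>{1..d}. (pm k x i - of_bool (x i))\<^sup>2)
      = (\<Sum>i\<in>{1..d}. E (\<lambda>x. (pm k x i - of_bool (x i))\<^sup>2))"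
    by (rule bernE_sum)
  also have "\<dots> \<le> (\<Sum>i\<in>{1..d}. E (\<lambda>x. (h i x - of_bool (x i))\<^sup>2))"
  proof (intro sum_mono cond_mean_optimal[OF _ p_range])
    fix i x y assume "obs k x = obs k y"
    then show "h i x = h i y"
      by (cases "i \<in> greedy d p \<pi> k x") (auto simp: h_def dest: fun_cong[of _ _ i])
  qed auto
  also have "\<dots> = E (\<lambda>x. \<Sum>i\<in>{1..d}. (h i x - of_bool (x i))\<^sup>2)"
    by (rule bernE_sum[symmetric])
  also have "\<dots> = E (\<lambda>x. \<Sum>j\<in>{1..d}. (h (\<pi> j) x - of_bool (x (\<pi> j)))\<^sup>2)"
    by (intro bernE_cong sum.reindex_bij_betw[OF bij, where g = "\<lambda>i. (h i _ - of_bool (_ i))\<^sup>2", symmetric])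
  also have "\<dots> \<le> E (\<lambda>x. \<bar>real k - real (card (ones b (s x)))\<bar> +
      (\<Sum>j\<in>{b<..d}. (q j - of_bool (s x j))\<^sup>2))"
  proof (rule E_mono)
    fix x
    have "(\<Sum>j\<in>{1..d}. (h (\<pi> j) x - of_bool (x (\<pi> j)))\<^sup>2)
        \<le> (\<Sum>j\<in>{1..d}. of_bool (j \<in> ones b (s x) - G k x) + of_bool (j \<in> {b<..d}) * (q j - of_bool (s x j))\<^sup>2)"
    proof (rule sum_mono)
      fix j assume j: "j \<in> {1..d}"
      have "\<pi> j \<in> \<pi> ` {1..b} \<longleftrightarrow> j \<le> b"
        using \<pi>_eq_iff[OF j] b j by force
      then show "(h (\<pi> j) x - of_bool (x (\<pi> j)))\<^sup>2
        \<le> of_bool (j \<in> ones b (s x) - G k x) + of_bool (j \<in> {b<..d}) * (q j - of_bool (s x j))\<^sup>2"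
        using j sq_error_star[of p "\<pi> j" x]
        by (auto simp: h_def in_greedy_iff ones_def s_def q_def xstar_def)
    qed
    also have "\<dots> = card (ones b (s x) - G k x) + (\<Sum>j\<in>{b<..d}. (q j - of_bool (s x j))\<^sup>2)"
    proof -
      have "{1..d} \<inter> (ones b (s x) - G k x) = ones b (s x) - G k x" using b by (auto simp: ones_def)
      moreover have "(\<Sum>j\<in>{1..d}. of_bool (j \<in> {b<..d}) * (q j - of_bool (s x j))\<^sup>2)
          = (\<Sum>j\<in>{b<..d}. (q j - of_bool (s x j))\<^sup>2)"
        by (rule sum.mono_neutral_cong_right) auto
      ultimately show ?thesis
        unfolding sum.distrib by (simp add: sum_of_bool_eq Int_def del: Diff_iff)
    qed
    also have "real (card (ones b (s x) - G k x)) \<le> \<bar>real k - real (card (ones b (s x)))\<bar>"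
    proof -
      have "card (ones b (s x) - G k x) \<le> card (sym_diff (G k x) (ones b (s x)))"
        using finite_subset[OF G_subset] by (intro card_mono) auto
      then show ?thesis
        using card_sym_diff_greedy[OF b, of k "s x"] unfolding G_def by linarith
    qed
    finally show "(\<Sum>j\<in>{1..d}. (h (\<pi> j) x - of_bool (x (\<pi> j)))\<^sup>2)
        \<le> \<bar>real k - real (card (ones b (s x)))\<bar> + (\<Sum>j\<in>{b<..d}. (q j - of_bool (s x j))\<^sup>2)"
      by simp
  qed
  also have "\<dots> = E (\<lambda>x. \<bar>real k - real (card (ones b (s x)))\<bar>) +
      (\<Sum>j\<in>{b<..d}. E (\<lambda>x. (q j - of_bool (s x j))\<^sup>2))"
    by (simp only: bernE_add bernE_sum)
  also have "(\<Sum>j\<in>{b<..d}. E (\<lambda>x. (q j - of_bool (s x j))\<^sup>2)) = (\<Sum>j\<in>{b<..d}. q j * (1 - q j))"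
    by (intro sum.cong refl E_sq_error) auto
  finally show ?thesis .
qed

lemma obs_upd_eq:
  assumes j: "j \<in> {1..d}" and sat: "k \<le> card (ones (j - 1) (s x))"
  shows "obs k (x(\<pi> j := c)) = obs k (x(\<pi> j := c'))"
proof -
  define S where "S = {l \<in> ones (j - 1) (s x). card (ones l (s x)) \<le> k}"
  have G: "G k (x(\<pi> j := c)) = S" for c
  proof -
    have "ones l (s (x(\<pi> j := c))) = ones l (s x)" if "l \<in> ones (j - 1) (s x)" for l
      using that j by (intro ones_upd) (auto simp: ones_def)
    moreover have "ones (j - 1) (s (x(\<pi> j := c))) = ones (j - 1) (s x)"
      using j by (intro ones_upd) auto
    moreover have "G k (x(\<pi> j := c)) =
        {l \<in> ones (j - 1) (s (x(\<pi> j := c))). card (ones l (s (x(\<pi> j := c)))) \<le> k}"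
      unfolding G_def using j sat by (intro greedy_positions_saturated) (auto simp: ones_upd)
    ultimately show ?thesis unfolding S_def by auto
  qed
  have "\<pi> j \<notin> \<pi> ` S"
    using \<pi>_eq_iff[OF j] j by (force simp: S_def ones_def)
  then show ?thesis
    unfolding greedy_G G by (auto simp: restrict_def fun_eq_iff)
qed

text \<open>
  When the first \<open>j - 1\<close> positions already contain \<open>k\<close> ones, the observation does not depend on
  position \<open>j\<close>, so resampling it costs at least the variance.
\<close>

lemma sophisticated_loss_lower_single:
  assumes j: "j \<in> {1..d}"
  shows "q j * (1 - q j) - E (\<lambda>x. of_bool (s x j \<and> card (ones (j - 1) (s x)) < k))
    \<le> E (\<lambda>x. (pm k x (\<pi> j) - of_bool (x (\<pi> j)))\<^sup>2)"
proof -
  let ?U = "\<lambda>x. of_bool (card (ones (j - 1) (s x)) < k) :: real"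
  let ?t = "p (\<pi> j) \<le> 1/2"
  have lt': "j - Suc 0 < j" using j by auto
  have q: "0 \<le> q j" "q j \<le> 1" using q_range[OF j] by auto
  have "q j * (1 - q j) - E (\<lambda>x. of_bool (s x j \<and> card (ones (j - 1) (s x)) < k))
      = q j * (1 - q j) - E (\<lambda>x. q j * ?U x)"
    by (subst resample[OF j]) (simp add: s_upd[OF j j] ones_upd[OF lt' j])
  also have "\<dots> = E (\<lambda>x. q j * (1 - q j) - q j * ?U x)"
    by (simp only: bernE_diff bernE_const finite_atLeastAtMost)
  also have "\<dots> \<le> E (\<lambda>x. q j * (pm k (x(\<pi> j := ?t)) (\<pi> j) - of_bool ?t)\<^sup>2
      + (1 - q j) * (pm k (x(\<pi> j := (\<not> ?t))) (\<pi> j) - of_bool (\<not> ?t))\<^sup>2)"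
  proof (rule E_mono)
    fix x
    let ?a = "pm k (x(\<pi> j := ?t)) (\<pi> j)" and ?a' = "pm k (x(\<pi> j := (\<not> ?t))) (\<pi> j)"
    show "q j * (1 - q j) - q j * ?U x \<le> q j * (?a - of_bool ?t)\<^sup>2 + (1 - q j) * (?a' - of_bool (\<not> ?t))\<^sup>2"
    proof (cases "card (ones (j - 1) (s x)) < k")
      case True
      have "q j * (1 - q j) - q j * ?U x \<le> 0" using True q by (simp add: mult_left_le)
      also have "0 \<le> q j * (?a - of_bool ?t)\<^sup>2 + (1 - q j) * (?a' - of_bool (\<not> ?t))\<^sup>2"
        using q by simp
      finally show ?thesis .
    next
      case False
      have "k \<le> card (ones (j - 1) (s x))" using False by simp
      then have "obs k (x(\<pi> j := ?t)) = obs k (x(\<pi> j := (\<not> ?t)))" by (rule obs_upd_eq[OF j])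
      then have "?a = ?a'" by (simp only:)
      moreover have "q j * (1 - q j) \<le> q j * (c - of_bool t)\<^sup>2 + (1 - q j) * (c - of_bool (\<not> t))\<^sup>2" for c t
      proof -
        have "q j * (c - of_bool t)\<^sup>2 + (1 - q j) * (c - of_bool (\<not> t))\<^sup>2 - q j * (1 - q j)
            = (c - (if t then q j else 1 - q j))\<^sup>2"
          by (simp add: power2_eq_square algebra_simps)
        then show ?thesis by (metis diff_ge_0_iff_ge zero_le_power2)
      qed
      ultimately show ?thesis using False by simp
    qed
  qed
  also have "\<dots> = E (\<lambda>x. (pm k x (\<pi> j) - of_bool (x (\<pi> j)))\<^sup>2)"
    by (subst (2) resample[OF j]) (simp only: fun_upd_same)
  finally show ?thesis .
qed

lemma sophisticated_loss_lower:
  assumes b: "b \<le> d"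
  shows "(\<Sum>j\<in>{b<..d}. q j * (1 - q j)) - E (\<lambda>x. \<bar>real k - real (card (ones b (s x)))\<bar>)
    \<le> E (\<lambda>x. \<Sum>i\<in>{1..d}. (pm k x i - of_bool (x i))\<^sup>2)"
proof -
  have "E (\<lambda>x. \<Sum>j\<in>{b<..d}. of_bool (s x j \<and> card (ones (j - 1) (s x)) < k))
      \<le> E (\<lambda>x. \<bar>real k - real (card (ones b (s x)))\<bar>)"
  proof (rule E_mono)
    fix x
    show "(\<Sum>j\<in>{b<..d}. of_bool (s x j \<and> card (ones (j - 1) (s x)) < k))
        \<le> \<bar>real k - real (card (ones b (s x)))\<bar>"
      using card_unsaturated_ones[OF b, of "s x" k]
      by (subst sum_of_bool_eq) (simp_all add: Int_def)
  qed
  then have "(\<Sum>j\<in>{b<..d}. q j * (1 - q j)) - E (\<lambda>x. \<bar>real k - real (card (ones b (s x)))\<bar>)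
      \<le> (\<Sum>j\<in>{b<..d}. q j * (1 - q j) - E (\<lambda>x. of_bool (s x j \<and> card (ones (j - 1) (s x)) < k)))"
    unfolding bernE_sum sum_subtractf by linarith
  also have "\<dots> \<le> (\<Sum>j\<in>{b<..d}. E (\<lambda>x. (pm k x (\<pi> j) - of_bool (x (\<pi> j)))\<^sup>2))"
    by (intro sum_mono sophisticated_loss_lower_single) auto
  also have "\<dots> = E (\<lambda>x. \<Sum>j\<in>{b<..d}. (pm k x (\<pi> j) - of_bool (x (\<pi> j)))\<^sup>2)"
    by (rule bernE_sum[symmetric])
  also have "\<dots> \<le> E (\<lambda>x. \<Sum>j\<in>{1..d}. (pm k x (\<pi> j) - of_bool (x (\<pi> j)))\<^sup>2)"
    by (intro E_mono sum_mono2) auto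
  also have "\<dots> = E (\<lambda>x. \<Sum>i\<in>{1..d}. (pm k x i - of_bool (x i))\<^sup>2)"
    by (intro bernE_cong sum.reindex_bij_betw[OF bij, where g = "\<lambda>i. (pm k _ i - of_bool (_ i))\<^sup>2"])
  finally show ?thesis .
qed

end

section \<open>Convergence of empirical quantiles\<close>

lemma
  assumes F_mono: "mono_on {0..1} F"
  shows mono_on_Fstar: "mono_on {0..1} (Fstar F)"
    and Fstar_half: "Fstar F (1/2) = 1"
proof -
  have F: "F s \<le> F t" if "0 \<le> s" "s \<le> t" "t \<le> 1" for s t
    using mono_onD[OF F_mono] that by auto
  show "mono_on {0..1} (Fstar F)"
  proof (rule mono_onI)
    fix s t :: real assume st: "s \<in> {0..1}" "t \<in> {0..1}" "s \<le> t"
    show "Fstar F s \<le> Fstar F t"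
      using F[of s t] F[of "1 - t" "1 - s"] F[of s "1 - s"] st by (auto simp: Fstar_def)
  qed
  show "Fstar F (1/2) = 1" by (simp add: Fstar_def)
qed

context
  fixes F :: "real \<Rightarrow> real"
  assumes F_mono: "mono_on {0..1} F"
begin

lemma Qstar_range:
  assumes "u \<le> 1"
  shows "0 \<le> Qstar F u \<and> Qstar F u \<le> 1/2"
proof
  have half: "1/2 \<in> {t \<in> {0..1}. Fstar F t \<ge> u}"
    using assms Fstar_half[OF F_mono] by simp
  then show "0 \<le> Qstar F u"
    unfolding Qstar_def by (intro cInf_greatest) (blast, simp)
  show "Qstar F u \<le> 1/2"
    unfolding Qstar_def by (rule cInf_lower[OF half]) (auto intro: bdd_belowI[of _ 0])
qed

lemma Fstar_less_if_less_Qstar: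
  assumes "t \<in> {0..1}" "t < Qstar F u"
  shows "Fstar F t < u"
proof (rule ccontr)
  assume "\<not> Fstar F t < u"
  then have "Qstar F u \<le> t"
    unfolding Qstar_def using assms by (intro cInf_lower) (auto intro: bdd_belowI[of _ 0])
  then show False using assms by simp
qed

lemma ex_Fstar_ge_if_Qstar_less:
  assumes "u \<le> 1" "Qstar F u < t"
  obtains s where "s \<in> {0..1}" "s < t" "u \<le> Fstar F s"
proof -
  have "1/2 \<in> {t \<in> {0..1}. Fstar F t \<ge> u}"
    using assms Fstar_half[OF F_mono] by simp
  then show ?thesis
    using cInf_lessD[of "{t \<in> {0..1}. Fstar F t \<ge> u}" t] assms(2) that
    unfolding Qstar_def by blast
qed

lemma mono_on_Qstar: "mono_on {..1} (Qstar F)"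
proof (rule mono_onI)
  fix u v :: real assume uv: "u \<in> {..1}" "v \<in> {..1}" "u \<le> v"
  have "1/2 \<in> {t \<in> {0..1}. Fstar F t \<ge> v}"
    using uv Fstar_half[OF F_mono] by simp
  then show "Qstar F u \<le> Qstar F v"
    unfolding Qstar_def using uv
    by (intro cInf_superset_mono) (blast, auto intro: bdd_belowI[of _ 0])
qed

lemma ex_symmetric_continuity_point:
  assumes "0 \<le> a" "a < b" "b \<le> 1"
  obtains t where "a < t" "t < b" "continuous (at t within {0..1}) F"
    "continuous (at (1 - t) within {0..1}) F"
proof -
  let ?D = "{t\<in>{0..1}. \<not> continuous (at t within {0..1}) F}"
  have "countable (?D \<union> (\<lambda>t. 1 - t) ` ?D)"
    using mono_on_ctble_discont[OF F_mono] by simp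
  then have "\<not> {a<..<b} \<subseteq> ?D \<union> (\<lambda>t. 1 - t) ` ?D"
    using uncountable_open_interval[of a b] assms countable_subset by blast
  then obtain t where tab: "t \<in> {a<..<b}" and t: "t \<notin> ?D \<union> (\<lambda>t. 1 - t) ` ?D"
    unfolding subset_eq Ball_def not_all not_imp by (elim exE conjE)
  have "1 - t \<notin> ?D"
  proof
    assume "1 - t \<in> ?D"
    then have "1 - (1 - t) \<in> (\<lambda>t. 1 - t) ` ?D" by (rule imageI)
    then show False using t by simp
  qed
  moreover have "t \<notin> ?D" using t by simp
  moreover have "t \<in> {0..1}" "1 - t \<in> {0..1}" using tab assms by auto
  ultimately have "continuous (at t within {0..1}) F" "continuous (at (1 - t) within {0..1}) F"
    by simp_all
  then show ?thesis using tab by (intro that[of t]) simp_all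
qed

end

context ordered_bernoulli
begin

lemma card_pstar_le: "card {i \<in> {1..d}. pstar p i \<le> t} = card {j \<in> {1..d}. q j \<le> t}"
proof -
  have "{i \<in> \<pi> ` {1..d}. pstar p i \<le> t} = \<pi> ` {j \<in> {1..d}. q j \<le> t}"
    unfolding q_def by blast
  then have "{i \<in> {1..d}. pstar p i \<le> t} = \<pi> ` {j \<in> {1..d}. q j \<le> t}"
    using bij by (simp only: bij_betw_def)
  moreover have "inj_on \<pi> {j \<in> {1..d}. q j \<le> t}"
    using bij by (auto simp: bij_betw_def intro: inj_on_subset)
  ultimately show ?thesis by (simp add: card_image)
qed

lemma q_mono: "i \<in> {1..d} \<Longrightarrow> j \<in> {1..d} \<Longrightarrow> i \<le> j \<Longrightarrow> q i \<le> q j"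
  using ordering by (auto simp: pstar_ordering_def q_def mono_on_def)

lemma q_le_iff:
  assumes j: "j \<in> {1..d}"
  shows "q j \<le> t \<longleftrightarrow> j \<le> card {i \<in> {1..d}. pstar p i \<le> t}"
proof
  assume "q j \<le> t"
  then have "{1..j} \<subseteq> {l \<in> {1..d}. q l \<le> t}"
    using j q_mono[OF _ j] by force
  from card_mono[OF _ this] show "j \<le> card {i \<in> {1..d}. pstar p i \<le> t}"
    unfolding card_pstar_le by simp
next
  assume *: "j \<le> card {i \<in> {1..d}. pstar p i \<le> t}"
  show "q j \<le> t"
  proof (rule ccontr)
    assume "\<not> q j \<le> t"
    have "{l \<in> {1..d}. q l \<le> t} \<subseteq> {1..<j}"
    proof
      fix l assume l: "l \<in> {l \<in> {1..d}. q l \<le> t}"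
      then have "l < j" using q_mono[OF j, of l] \<open>\<not> q j \<le> t\<close> by (cases "j \<le> l") auto
      then show "l \<in> {1..<j}" using l by simp
    qed
    from card_mono[OF _ this] have "card {l \<in> {1..d}. q l \<le> t} \<le> j - 1" by simp
    moreover have "j \<le> card {l \<in> {1..d}. q l \<le> t}" using * unfolding card_pstar_le .
    moreover have "1 \<le> j" using j by simp
    ultimately show False by linarith
  qed
qed

lemma
  assumes "t < 1/2"
  shows card_pstar_lower: "card {i \<in> {1..d}. p i \<le> t} + real d - card {i \<in> {1..d}. p i \<le> 1 - t}
      \<le> card {i \<in> {1..d}. pstar p i \<le> t}"
    and card_pstar_upper: "a < t \<Longrightarrow> card {i \<in> {1..d}. pstar p i \<le> a}
      \<le> card {i \<in> {1..d}. p i \<le> t} + real d - card {i \<in> {1..d}. p i \<le> 1 - t}"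
proof -
  let ?A = "{i \<in> {1..d}. p i \<le> t}" and ?B = "{1..d} - {i \<in> {1..d}. p i \<le> 1 - t}"
  have "card ?B = d - card {i \<in> {1..d}. p i \<le> 1 - t}"
    by (subst card_Diff_subset) auto
  moreover have "card {i \<in> {1..d}. p i \<le> 1 - t} \<le> d"
    by (rule order_trans[OF card_mono[of "{1..d}"]]) auto
  moreover have "card (?A \<union> ?B) = card ?A + card ?B"
    by (rule card_Un_disjoint) (use assms in auto)
  ultimately have AB: "real (card (?A \<union> ?B)) = card ?A + real d - card {i \<in> {1..d}. p i \<le> 1 - t}"
    by (simp add: of_nat_diff)
  have "card (?A \<union> ?B) \<le> card {i \<in> {1..d}. pstar p i \<le> t}"
    by (rule card_mono) (auto simp: pstar_def)
  then show "card ?A + real d - card {i \<in> {1..d}. p i \<le> 1 - t} \<le> card {i \<in> {1..d}. pstar p i \<le> t}"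
    using AB by linarith
  show "card {i \<in> {1..d}. pstar p i \<le> a} \<le> card ?A + real d - card {i \<in> {1..d}. p i \<le> 1 - t}" if "a < t"
  proof -
    have "card {i \<in> {1..d}. pstar p i \<le> a} \<le> card (?A \<union> ?B)"
      by (rule card_mono) (use that in \<open>auto simp: pstar_def\<close>)
    then show ?thesis using AB by linarith
  qed
qed

end

lemma quantile_tendsto:
  assumes F_mono: "mono_on {0..1} F"
    and ob: "\<And>d. d \<ge> 1 \<Longrightarrow> ordered_bernoulli d (p d) (\<pi> d)"
    and F_limit: "\<And>t. t \<in> {0..1} \<Longrightarrow> continuous (at t within {0..1}) F \<Longrightarrow>
      (\<lambda>d. real (card {i \<in> {1..d}. p d i \<le> t}) / real d) \<longlonglongrightarrow> F t"
    and u: "u \<in> {0<..<1}" and cont: "isCont (Qstar F) u"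
  shows "(\<lambda>d. ordered_bernoulli.q (p d) (\<pi> d) (nat \<lceil>real d * u\<rceil>)) \<longlonglongrightarrow> Qstar F u"
proof -
  let ?q = "\<lambda>d. ordered_bernoulli.q (p d) (\<pi> d)" and ?j = "\<lambda>d. nat \<lceil>real d * u\<rceil>"
  let ?R = "\<lambda>t d. real (card {i \<in> {1..d}. p d i \<le> t}) + real d - card {i \<in> {1..d}. p d i \<le> 1 - t}"
  have j: "?j d \<in> {1..d}" if "d \<ge> 1" for d
  proof -
    have "0 < real d * u" "real d * u \<le> real d" using that u by (auto intro: mult_left_le)
    then show ?thesis by (simp add: Suc_le_eq nat_le_iff ceiling_le_iff)
  qed
  have R: "(\<lambda>d. ?R t d / d) \<longlonglongrightarrow> Fstar F t"
    if "0 \<le> t" "t \<le> 1/2" "continuous (at t within {0..1}) F" "continuous (at (1 - t) within {0..1}) F" for t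
  proof -
    have "(\<lambda>d. real (card {i \<in> {1..d}. p d i \<le> t}) / d + 1 - card {i \<in> {1..d}. p d i \<le> 1 - t} / d) \<longlonglongrightarrow> F t + 1 - F (1 - t)"
      using that by (intro tendsto_intros F_limit) auto
    moreover have "\<forall>\<^sub>F d in sequentially. real (card {i \<in> {1..d}. p d i \<le> t}) / d + 1 - card {i \<in> {1..d}. p d i \<le> 1 - t} / d
        = ?R t d / d"
      using eventually_gt_at_top[of 0] by eventually_elim (simp add: field_simps)
    ultimately show ?thesis
      using that by (simp add: Fstar_def tendsto_cong)
  qed
  show ?thesis
  proof (rule order_tendstoI)
    fix a assume a: "a < Qstar F u"
    show "\<forall>\<^sub>F d in sequentially. a < ?q d (?j d)"
    proof (cases "a < 0")
      case True
      show ?thesis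
        using eventually_ge_at_top[of 1]
      proof eventually_elim
        case (elim d)
        then show ?case using ordered_bernoulli.q_range[OF ob[OF elim] j[OF elim]] True by linarith
      qed
    next
      case False
      then obtain t where t: "a < t" "t < Qstar F u" "continuous (at t within {0..1}) F"
          "continuous (at (1 - t) within {0..1}) F"
        using ex_symmetric_continuity_point[OF F_mono, of a "Qstar F u"] a Qstar_range[OF F_mono, of u] u
        by auto
      then have t2: "0 \<le> t" "t < 1/2" using False Qstar_range[OF F_mono, of u] u by auto
      have "Fstar F t < u"
        by (rule Fstar_less_if_less_Qstar[OF F_mono]) (use t t2 in auto)
      then have "\<forall>\<^sub>F d in sequentially. ?R t d / d < u"
        using order_tendstoD(2)[OF R] t t2 by simp
      then show ?thesis
        using eventually_ge_at_top[of 1]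
      proof eventually_elim
        case (elim d)
        interpret ordered_bernoulli d "p d" "\<pi> d" by (rule ob[OF elim(2)])
        have "card {i \<in> {1..d}. pstar (p d) i \<le> a} < real d * u"
          using card_pstar_upper[OF t2(2) t(1)] elim by (simp add: field_simps)
        also have "\<dots> \<le> ?j d" by linarith
        finally have "\<not> ?j d \<le> card {i \<in> {1..d}. pstar (p d) i \<le> a}"
          by (simp only: of_nat_less_iff not_le)
        then show ?case unfolding q_le_iff[OF j[OF elim(2)], symmetric] by simp
      qed
    qed
  next
    fix a assume a: "Qstar F u < a"
    show "\<forall>\<^sub>F d in sequentially. ?q d (?j d) < a"
    proof (cases "a > 1/2")
      case True
      show ?thesis
        using eventually_ge_at_top[of 1]
      proof eventually_elim
        case (elim d)
        then show ?case using ordered_bernoulli.q_range[OF ob[OF elim] j[OF elim]] True by linarith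
      qed
    next
      case False
      have "\<forall>\<^sub>F v in at_right u. Qstar F v < a"
        using cont a by (auto simp: isCont_def intro: order_tendstoD(2) filterlim_at_split[THEN iffD1, THEN conjunct2])
      moreover have "\<forall>\<^sub>F v in at_right u. v \<in> {u<..<1}"
        using u by (intro eventually_at_right_real) auto
      ultimately obtain v where v: "Qstar F v < a" "u < v" "v < 1"
        using eventually_happens[OF eventually_conj] trivial_limit_at_right_real by (metis (no_types, lifting) greaterThanLessThan_iff)
      obtain s where s: "s \<in> {0..1}" "s < a" "v \<le> Fstar F s"
        using ex_Fstar_ge_if_Qstar_less[OF F_mono _ v(1)] v by auto
      obtain t where t: "s < t" "t < a" "continuous (at t within {0..1}) F"
          "continuous (at (1 - t) within {0..1}) F"
        using ex_symmetric_continuity_point[OF F_mono, of s a] s False by auto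
      have t2: "0 \<le> t" "t < 1/2" using s t False by auto
      have "u < Fstar F t"
        using mono_onD[OF mono_on_Fstar[OF F_mono], of s t] s t t2 v by auto
      then have "\<forall>\<^sub>F d in sequentially. u < ?R t d / d"
        using order_tendstoD(1)[OF R] t t2 by simp
      then show ?thesis
        using eventually_ge_at_top[of 1]
      proof eventually_elim
        case (elim d)
        interpret ordered_bernoulli d "p d" "\<pi> d" by (rule ob[OF elim(2)])
        have "real d * u < card {i \<in> {1..d}. pstar (p d) i \<le> t}"
          using card_pstar_lower[OF t2(2)] elim by (simp add: field_simps)
        then have "?j d \<le> card {i \<in> {1..d}. pstar (p d) i \<le> t}" by linarith
        then show ?case unfolding q_le_iff[OF j[OF elim(2)], symmetric] using t by simp
      qed
    qed
  qed
qed

lemma has_integral_step: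
  fixes h :: "nat \<Rightarrow> real"
  assumes "d > 0"
  shows "((\<lambda>u. h (nat \<lceil>real d * u\<rceil>)) has_integral (\<Sum>j=1..b. h j) / d) {0..b / d}"
proof (induction b)
  case 0
  then show ?case by (simp add: has_integral_refl)
next
  case (Suc b)
  let ?f = "\<lambda>u. h (nat \<lceil>real d * u\<rceil>)"
  have "((\<lambda>u. h (Suc b)) has_integral h (Suc b) * (Suc b / d - b / d)) {b / d..Suc b / d}"
    using has_integral_const_real[of "h (Suc b)" "b / d" "Suc b / d"] assms
    by (simp add: divide_right_mono mult.commute)
  then have "(?f has_integral h (Suc b) * (Suc b / d - b / d)) {b / d..Suc b / d}"
  proof (rule has_integral_spike_finite[of "{b / d}", rotated 2])
    fix u assume "u \<in> {b / d..Suc b / d} - {b / d}"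
    then have "real b < real d * u" "real d * u \<le> Suc b"
      using assms by (auto simp: field_simps)
    then have "nat \<lceil>real d * u\<rceil> = Suc b" by linarith
    then show "?f u = h (Suc b)" by simp
  qed auto
  from has_integral_combine[OF _ _ Suc this] show ?case
    using assms by (simp add: divide_right_mono field_simps)
qed

lemma floor_frac_tendsto: "(\<lambda>d. real (nat \<lfloor>\<beta> * real d\<rfloor>) / real d) \<longlonglongrightarrow> \<beta>" if "\<beta> \<ge> 0"
proof (rule tendsto_sandwich)
  show "\<forall>\<^sub>F d in sequentially. \<beta> - 1 / real d \<le> real (nat \<lfloor>\<beta> * real d\<rfloor>) / real d"
    using eventually_gt_at_top[of 0]
  proof eventually_elim
    case (elim d)
    have "(\<beta> * d - 1) / d \<le> real (nat \<lfloor>\<beta> * real d\<rfloor>) / d"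
      by (intro divide_right_mono) linarith+
    then show ?case using elim by (simp add: diff_divide_distrib)
  qed
  show "\<forall>\<^sub>F d in sequentially. real (nat \<lfloor>\<beta> * real d\<rfloor>) / real d \<le> \<beta>"
    using eventually_gt_at_top[of 0]
  proof eventually_elim
    case (elim d)
    have "0 \<le> \<beta> * d" using that by simp
    then have "real (nat \<lfloor>\<beta> * real d\<rfloor>) \<le> \<beta> * d" by linarith
    then show ?case using elim by (simp add: field_simps)
  qed
  have "(\<lambda>d. \<beta> - 1 / real d) \<longlonglongrightarrow> \<beta> - 0" by (intro tendsto_intros lim_1_over_n)
  then show "(\<lambda>d. \<beta> - 1 / real d) \<longlonglongrightarrow> \<beta>" by simp
qed simp

lemma quantile_sum_tendsto:
  fixes q :: "nat \<Rightarrow> nat \<Rightarrow> real" and Q g :: "real \<Rightarrow> real"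
  assumes N: "countable N"
    and conv: "\<And>u. u \<in> {0<..<1} - N \<Longrightarrow> (\<lambda>d. q d (nat \<lceil>real d * u\<rceil>)) \<longlonglongrightarrow> Q u"
    and q: "\<And>d j. j \<in> {1..d} \<Longrightarrow> q d j \<in> {0..1}"
    and g: "continuous_on UNIV g"
    and \<beta>: "\<beta> \<in> {0..1}"
  shows "(\<lambda>u. if u \<le> \<beta> then g (Q u) else 0) integrable_on {0..1}"
    and "(\<lambda>d. (\<Sum>j=1..nat \<lfloor>\<beta> * real d\<rfloor>. g (q d j)) / d) \<longlonglongrightarrow> integral {0..\<beta>} (\<lambda>u. g (Q u))"
proof -
  define b where "b d = nat \<lfloor>\<beta> * real d\<rfloor>" for d
  define f where "f d u = (if u \<in> {0..b d / real d} then g (q d (nat \<lceil>real d * u\<rceil>)) else 0)" for d u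
  define f0 where "f0 u = (if u \<le> \<beta> then g (Q u) else 0)" for u
  let ?N = "N \<union> {0, 1, \<beta>}"
  have neg: "negligible ?N"
    using N countable_imp_null_set_lborel[of ?N] null_sets_completionI
    unfolding negligible_iff_null_sets by blast
  have b: "b d \<le> d" for d
  proof -
    have "\<beta> * real d \<le> real d" using \<beta> by (intro mult_left_le_one_le) auto
    then show ?thesis unfolding b_def by linarith
  qed
  have "compact (g ` {0..1})"
    using continuous_on_subset[OF g] by (intro compact_continuous_image) auto
  then have "bounded (g ` {0..1})" by (rule compact_imp_bounded)
  then obtain C where "\<forall>x\<in>{0..1}. \<bar>g x\<bar> \<le> C" by (auto simp: bounded_iff)
  then have C: "\<bar>g x\<bar> \<le> C" if "x \<in> {0..1}" for x using that by blast
  have f_int: "(f d has_integral (\<Sum>j=1..b d. g (q d j)) / d) {0..1}" for d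
  proof (cases "d = 0")
    case True
    have "((\<lambda>_. 0) has_integral 0) {0..1::real}" by simp
    then have "(f 0 has_integral 0) {0..1}"
      by (rule has_integral_spike_finite[of "{0}", rotated 2]) (auto simp: f_def)
    then show ?thesis using True by simp
  next
    case False
    then have "{0..b d / d} \<subseteq> {0..1}" using b[of d] by (auto simp: field_simps intro: order_trans)
    then show ?thesis
      using has_integral_step[of d "\<lambda>j. g (q d j)" "b d"] False
      unfolding f_def by (subst has_integral_restrict) auto
  qed
  define f' where "f' d u = (if u \<in> ?N then 0 else f d u)" for d u
  define f0' where "f0' u = (if u \<in> ?N then 0 else f0 u)" for u
  have f'_int: "(f' d has_integral (\<Sum>j=1..b d. g (q d j)) / d) {0..1}" for d
    by (rule has_integral_spike[OF neg _ f_int]) (simp add: f'_def)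
  have bound: "norm (f' d u) \<le> C" if "u \<in> {0..1}" for d u
  proof (cases "u \<in> {0<..b d / d} - ?N")
    case True
    then have "d > 0" by (cases d) auto
    then have "0 < real d * u" "real d * u \<le> b d" using True by (auto simp: field_simps)
    then have "1 \<le> nat \<lceil>real d * u\<rceil>" "nat \<lceil>real d * u\<rceil> \<le> d" using b[of d] by linarith+
    then have "nat \<lceil>real d * u\<rceil> \<in> {1..d}" by simp
    then show ?thesis using True C[OF q] by (simp add: f'_def f_def)
  next
    case False
    have "0 \<le> C" using C[of 0] by simp
    then show ?thesis using False that by (auto simp: f'_def f_def)
  qed
  have ptw: "(\<lambda>d. f' d u) \<longlonglongrightarrow> f0' u" if "u \<in> {0..1}" for u
  proof (cases "u \<in> ?N")
    case False
    then have u: "u \<in> {0<..<1} - N" "u \<noteq> \<beta>" using that by auto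
    note bd = floor_frac_tendsto[of \<beta>, folded b_def]
    have "(\<lambda>d. f d u) \<longlonglongrightarrow> f0 u"
    proof (cases "u < \<beta>")
      case True
      then have "\<forall>\<^sub>F d in sequentially. u < b d / d"
        using order_tendstoD(1)[OF bd] \<beta> by simp
      then have "\<forall>\<^sub>F d in sequentially. g (q d (nat \<lceil>real d * u\<rceil>)) = f d u"
        by eventually_elim (use u in \<open>auto simp: f_def\<close>)
      moreover have "(\<lambda>d. g (q d (nat \<lceil>real d * u\<rceil>))) \<longlonglongrightarrow> g (Q u)"
        using g by (intro isCont_tendsto_compose[OF _ conv[OF u(1)]]) (simp add: continuous_on_eq_continuous_at)
      ultimately show ?thesis
        using True by (simp add: f0_def tendsto_cong)
    next
      case False
      then have "\<forall>\<^sub>F d in sequentially. b d / d < u"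
        using order_tendstoD(2)[OF bd] \<beta> u by simp
      then have "\<forall>\<^sub>F d in sequentially. f d u = 0"
        by eventually_elim (auto simp: f_def)
      then show ?thesis using False u by (simp add: f0_def tendsto_eventually)
    qed
    then show ?thesis using False by (simp add: f'_def f0'_def)
  qed (simp add: f'_def f0'_def)
  have C_int: "(\<lambda>_. C) integrable_on {0..1::real}" by (rule integrable_const_ivl)
  have f'_integrable: "f' d integrable_on {0..1}" for d using f'_int by blast
  have dc: "f0' integrable_on {0..1}" "(\<lambda>d. integral {0..1} (f' d)) \<longlonglongrightarrow> integral {0..1} f0'"
    by (rule dominated_convergence[OF f'_integrable C_int bound ptw]; assumption)+
  show "(\<lambda>u. if u \<le> \<beta> then g (Q u) else 0) integrable_on {0..1}"
    unfolding f0_def[symmetric] by (rule integrable_spike[OF dc(1) neg]) (simp add: f0'_def)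
  have "integral {0..1} f0' = integral {0..1} f0"
    by (rule integral_spike[OF neg]) (simp add: f0'_def)
  also have "\<dots> = integral {0..1} (\<lambda>u. if u \<in> {0..\<beta>} then g (Q u) else 0)"
    by (rule integral_cong) (auto simp: f0_def)
  also have "\<dots> = integral {0..\<beta>} (\<lambda>u. g (Q u))"
    using \<beta> by (subst integral_restrict_Int) (simp add: Int_absorb2)
  finally show "(\<lambda>d. (\<Sum>j=1..nat \<lfloor>\<beta> * real d\<rfloor>. g (q d j)) / d) \<longlonglongrightarrow> integral {0..\<beta>} (\<lambda>u. g (Q u))"
    using dc(2) unfolding b_def[symmetric] integral_unique[OF f'_int] by simp
qed

lemma tendsto_if_close:
  fixes f g e :: "nat \<Rightarrow> real"
  assumes "\<And>d. d \<ge> 1 \<Longrightarrow> \<bar>f d - g d\<bar> \<le> e d" "e \<longlonglongrightarrow> 0" "g \<longlonglongrightarrow> l"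
  shows "f \<longlonglongrightarrow> l"
proof -
  have "(\<lambda>d. f d - g d) \<longlonglongrightarrow> 0"
    by (rule Lim_null_comparison[OF eventually_sequentiallyI[of 1] assms(2)]) (simp add: assms(1))
  from tendsto_add[OF this assms(3)] show ?thesis by simp
qed

theorem theorem2:
  fixes M :: "nat \<Rightarrow> 'a measure"
    and X :: "nat \<Rightarrow> nat \<Rightarrow> 'a \<Rightarrow> bool"
    and p :: "nat \<Rightarrow> nat \<Rightarrow> real"
    and \<pi> :: "nat \<Rightarrow> nat \<Rightarrow> nat"
    and k :: "nat \<Rightarrow> nat"
    and F :: "real \<Rightarrow> real"
    and \<alpha> \<beta> :: real
  assumes p_range: "\<And>d i. i \<in> {1..d} \<Longrightarrow> p d i \<in> {0..1}"
    and prob: "\<And>d. d \<ge> 1 \<Longrightarrow> prob_space (M d)"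
    and indep: "\<And>d. d \<ge> 1 \<Longrightarrow>
      prob_space.indep_vars (M d) (\<lambda>_. count_space UNIV) (X d) {1..d}"
    and bern: "\<And>d i. i \<in> {1..d} \<Longrightarrow>
      distr (M d) (count_space UNIV) (X d i) = measure_pmf (bernoulli_pmf (p d i))"
    and ordering: "\<And>d. d \<ge> 1 \<Longrightarrow> pstar_ordering d (p d) (\<pi> d)"
    and alpha: "\<alpha> \<in> {0<..<1}"
    and bandwidth: "(\<lambda>d. real (k d) / real d) \<longlonglongrightarrow> \<alpha>"
    and F_range: "\<And>t. t \<in> {0..1} \<Longrightarrow> F t \<in> {0..1}"
    and F_mono: "mono_on {0..1} F"
    and F_cadlag: "cadlag_on 0 1 F"
    and F_0: "(F \<longlongrightarrow> 0) (at 0 within {0..1})"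
    and F_1: "(F \<longlongrightarrow> 1) (at 1 within {0..1})"
    and F_limit: "\<And>t. t \<in> {0..1} \<Longrightarrow> continuous (at t within {0..1}) F \<Longrightarrow>
      (\<lambda>d. real (card {i \<in> {1..d}. p d i \<le> t}) / real d) \<longlonglongrightarrow> F t"
    and alpha_bound: "\<alpha> \<in> {0<..<integral {0..1} (Qstar F)}"
    and beta: "\<beta> \<in> {0<..<1}"
    and beta_eq: "integral {0..\<beta>} (Qstar F) = \<alpha>"
  shows "((\<lambda>d. sophisticated_risk d (M d) (X d) (greedy d (p d) (\<pi> d) (k d))) \<longlonglongrightarrow>
            integral {\<beta>..1} (\<lambda>q. Qstar F q * (1 - Qstar F q))) \<and>
         ((\<lambda>d. naive_risk d (M d) (X d) (greedy d (p d) (\<pi> d) (k d))) \<longlonglongrightarrow>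
            integral {0..\<beta>} (\<lambda>q. (Qstar F q)\<^sup>2 * (1 - Qstar F q)) +
            integral {\<beta>..1} (\<lambda>q. Qstar F q * (1 - Qstar F q)))"
proof -
  have ob: "ordered_bernoulli d (p d) (\<pi> d)" if "d \<ge> 1" for d
    using that p_range ordering by unfold_locales auto
  define r where "r d = ordered_bernoulli.q (p d) (\<pi> d)" for d
  define b where "b d = nat \<lfloor>\<beta> * real d\<rfloor>" for d
  define e where "e d = (\<bar>real (k d) - (\<Sum>j=1..b d. r d j)\<bar> + sqrt d) / d" for d
  let ?Q = "Qstar F"
  let ?A = "\<lambda>d. (\<Sum>j=1..b d. (r d j)\<^sup>2 * (1 - r d j)) / d"
  let ?B = "\<lambda>d. (\<Sum>j\<in>{b d<..d}. r d j * (1 - r d j)) / d"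
  have b_le: "b d \<le> d" for d
  proof -
    have "\<beta> * real d \<le> real d" using beta by (intro mult_left_le_one_le) auto
    then show ?thesis unfolding b_def by linarith
  qed
  have bound: "\<bar>sophisticated_risk d (M d) (X d) (greedy d (p d) (\<pi> d) (k d)) - ?B d\<bar> \<le> e d
      \<and> \<bar>naive_risk d (M d) (X d) (greedy d (p d) (\<pi> d) (k d)) - (?A d + ?B d)\<bar> \<le> e d"
    if d: "d \<ge> 1" for d
  proof -
    interpret ordered_bernoulli d "p d" "\<pi> d" by (rule ob[OF d])
    interpret prob_space "M d" by (rule prob[OF d])
    let ?\<sigma> = "greedy d (p d) (\<pi> d) (k d)"
    have naive: "naive_risk d (M d) (X d) ?\<sigma> =
        E (\<lambda>x. \<Sum>i\<in>{1..d} - ?\<sigma> x. (p d i - of_bool (x i))\<^sup>2) / d"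
      by (rule naive_risk_eq[OF d indep[OF d] p_range bern greedy_subset])
    have soph: "sophisticated_risk d (M d) (X d) ?\<sigma> =
        E (\<lambda>x. \<Sum>i\<in>{1..d}. (pm (k d) x i - of_bool (x i))\<^sup>2) / d"
      by (rule sophisticated_risk_eq[OF d indep[OF d] p_range bern greedy_subset])
    let ?D = "E (\<lambda>x. \<bar>real (k d) - real (card (ones (b d) (s x)))\<bar>)"
    have D: "?D \<le> e d * d"
      using E_abs_dev[OF b_le[of d] d, of "k d"] d by (simp add: e_def r_def)
    have scale: "\<bar>x / d - y / d\<bar> \<le> e d" if "\<bar>x - y\<bar> \<le> ?D" for x y :: real
    proof -
      have "\<bar>x / d - y / d\<bar> = \<bar>x - y\<bar> / d"
        by (simp flip: diff_divide_distrib)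
      also have "\<dots> \<le> e d"
        using that D d by (simp add: divide_le_eq)
      finally show ?thesis .
    qed
    have "\<bar>naive_risk d (M d) (X d) (greedy d (p d) (\<pi> d) (k d)) - (?A d + ?B d)\<bar> \<le> e d"
      unfolding naive add_divide_distrib[symmetric] r_def
      by (rule scale) (rule naive_loss_bound[OF b_le])
    moreover have "\<bar>sophisticated_risk d (M d) (X d) (greedy d (p d) (\<pi> d) (k d)) - ?B d\<bar> \<le> e d"
      unfolding soph r_def
      by (rule scale)
        (use sophisticated_loss_upper[OF b_le[of d], of "k d"]
          sophisticated_loss_lower[OF b_le[of d], of "k d"] in linarith)
    ultimately show ?thesis by simp
  qed
  let ?N = "{u \<in> {0<..<1}. \<not> isCont ?Q u}"
  have N: "countable ?N"
    by (rule mono_on_ctble_discont_open) (auto intro: mono_on_subset[OF mono_on_Qstar[OF F_mono]])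
  have conv: "(\<lambda>d. r d (nat \<lceil>real d * u\<rceil>)) \<longlonglongrightarrow> ?Q u" if "u \<in> {0<..<1} - ?N" for u
    unfolding r_def by (rule quantile_tendsto[OF F_mono ob F_limit]) (use that in auto)
  have r_range: "r d j \<in> {0..1}" if "j \<in> {1..d}" for d j
    using ordered_bernoulli.q_range[OF ob that] that by (auto simp: r_def)
  have sums: "(\<lambda>u. if u \<le> c then h (?Q u) else 0) integrable_on {0..1}"
    "(\<lambda>d. (\<Sum>j=1..nat \<lfloor>c * real d\<rfloor>. h (r d j)) / d) \<longlonglongrightarrow> integral {0..c} (\<lambda>u. h (?Q u))"
    if "continuous_on UNIV h" "c \<in> {0..1}" for h c
    by (rule quantile_sum_tendsto[where q = r and Q = ?Q, OF N conv r_range that]; assumption)+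
  have \<beta>: "\<beta> \<in> {0..1}" and one: "(1::real) \<in> {0..1}" using beta by auto
  let ?g = "\<lambda>x::real. x * (1 - x)"
  have g: "continuous_on UNIV ?g" by (intro continuous_intros)
  have int: "(\<lambda>u. ?g (?Q u)) integrable_on {0..1}"
    by (rule integrable_eq[OF sums(1)[OF g one]]) auto
  have "(\<lambda>d. (\<Sum>j=1..nat \<lfloor>1 * real d\<rfloor>. ?g (r d j)) / d - (\<Sum>j=1..b d. ?g (r d j)) / d)
      \<longlonglongrightarrow> integral {0..1} (\<lambda>u. ?g (?Q u)) - integral {0..\<beta>} (\<lambda>u. ?g (?Q u))"
    unfolding b_def by (intro tendsto_diff sums(2)[OF g one] sums(2)[OF g \<beta>])
  also have "integral {0..1} (\<lambda>u. ?g (?Q u)) - integral {0..\<beta>} (\<lambda>u. ?g (?Q u))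
      = integral {\<beta>..1} (\<lambda>u. ?g (?Q u))"
    using Henstock_Kurzweil_Integration.integral_combine[OF _ _ int, of \<beta>] beta by simp
  also have "(\<lambda>d. (\<Sum>j=1..nat \<lfloor>1 * real d\<rfloor>. ?g (r d j)) / d - (\<Sum>j=1..b d. ?g (r d j)) / d) = ?B"
  proof
    fix d
    have "{1..d} = {1..b d} \<union> {b d<..d}" using b_le[of d] by auto
    then have "(\<Sum>j=1..d. ?g (r d j)) = (\<Sum>j=1..b d. ?g (r d j)) + (\<Sum>j\<in>{b d<..d}. ?g (r d j))"
      by (simp only:) (rule sum.union_disjoint, auto)
    then show "(\<Sum>j=1..nat \<lfloor>1 * real d\<rfloor>. ?g (r d j)) / d - (\<Sum>j=1..b d. ?g (r d j)) / d = ?B d"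
      by (simp add: add_divide_distrib)
  qed
  finally have B: "?B \<longlonglongrightarrow> integral {\<beta>..1} (\<lambda>u. ?g (?Q u))" .
  have A: "?A \<longlonglongrightarrow> integral {0..\<beta>} (\<lambda>u. (?Q u)\<^sup>2 * (1 - ?Q u))"
    unfolding b_def
    by (rule sums(2)[where h = "\<lambda>x. x\<^sup>2 * (1 - x)", OF _ \<beta>]) (intro continuous_intros)
  have S: "(\<lambda>d. (\<Sum>j=1..b d. r d j) / d) \<longlonglongrightarrow> \<alpha>"
    unfolding b_def beta_eq[symmetric]
    by (rule sums(2)[where h = "\<lambda>x. x", OF _ \<beta>]) (intro continuous_intros)
  have "(\<lambda>d. inverse (sqrt (real d))) \<longlonglongrightarrow> 0"
    by (intro tendsto_inverse_0_at_top filterlim_compose[OF sqrt_at_top filterlim_real_sequentially])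
  with S bandwidth have "(\<lambda>d. \<bar>real (k d) / d - (\<Sum>j=1..b d. r d j) / d\<bar> + inverse (sqrt d)) \<longlonglongrightarrow> \<bar>\<alpha> - \<alpha>\<bar> + 0"
    by (intro tendsto_intros)
  moreover have "\<bar>real (k d) / d - (\<Sum>j=1..b d. r d j) / d\<bar> + inverse (sqrt d) = e d" for d
  proof -
    have "sqrt d / d = inverse (sqrt d)"
      by (rule sqrt_divide_self_eq) simp
    then show ?thesis
      by (simp add: e_def add_divide_distrib flip: diff_divide_distrib)
  qed
  ultimately have e: "e \<longlonglongrightarrow> 0" by simp
  show ?thesis
    using tendsto_if_close[OF conjunct1[OF bound] e B]
      tendsto_if_close[OF conjunct2[OF bound] e tendsto_add[OF A B]]
    by simp
qed

end
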